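(* Let $\mathcal{A}\subset\mathbb{R}^n$ be compact and let $\mathcal{H}=(C,f,D,g)$ be a hybrid system with inputs satisfying the hybrid basic conditions. Suppose there exists a control Lyapunov function $V$ with $\mathcal{U}$ controls for $\mathcal{H}$ (with respect to $\mathcal{A}$). Suppose furthermore that: (M1) the set-valued maps $\Psi_c$ and $\Psi_d$ are lower semicontinuous with convex values; (M2) for every $r>0$ and every $x\in\Pi(C)\cap\mathcal{I}(r)$, the function $u_c\mapsto\Gamma_c(x,u_c,r)$ is convex on $\Psi_c(x)$, and, for every $r>0$ and every $x\in\Pi(D)\cap\mathcal{I}(r)$, the function $u_d\mapsto\Gamma_d(x,u_d,r)$ is convex on $\Psi_d(x)$. Then, for every $r>0$, the state-feedback law pair $\rho_c:R_c\cap\mathcal{I}(r)\to\mathcal{U}_c$, $\rho_d:R_d\cap\mathcal{I}(r)\to\mathcal{U}_d$ defined as $$\rho_c(x):=\arg\min\{|u_c| : u_c\in\mathcal{T}_c(x)\}\quad\forall x\in R_c\cap\mathcal{I}(r),$$ $$\rho_d(x):=\arg\min\{|u_d| : u_d\in\mathcal{T}_d(x)\}\quad\forall x\in R_d\cap\mathcal{I}(r)$$ renders the compact set $\mathcal{A}_r:=\{x\in\mathbb{R}^n : V(x)\le r\}$ asymptotically stable for the restricted hybrid system $\mathcal{H}_{\mathcal{I}}$. Furthermore, if the set-valued maps $\Psi_c$ and $\Psi_d$ have closed graph, then $\rho_c$ and $\rho_d$ are continuous.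
   Context: Hybrid system. Let $\mathcal{U}_c\subset\mathbb{R}^{m_c}$, $\mathcal{U}_d\subset\mathbb{R}^{m_d}$, $\mathcal{U}=\mathcal{U}_c\times\mathcal{U}_d$. A hybrid system $\mathcal{H}=(C,f,D,g)$ with state $x\in\mathbb{R}^n$ and input $u=(u_c,u_d)\in\mathcal{U}$ is $$\dot x=f(x,u_c),\ (x,u_c)\in C;\qquad x^+=g(x,u_d),\ (x,u_d)\in D,$$ with $C\subset\mathbb{R}^n\times\mathcal{U}_c$, $D\subset\mathbb{R}^n\times\mathcal{U}_d$, $f:\mathbb{R}^n\times\mathbb{R}^{m_c}\to\mathbb{R}^n$, $g:\mathbb{R}^n\times\mathbb{R}^{m_d}\to\mathbb{R}^n$. It satisfies the hybrid basic conditions if $C$ and $D$ are closed subsets of $\mathbb{R}^n\times\mathcal{U}_c$ and $\mathbb{R}^n\times\mathcal{U}_d$, respectively, and $f$ and $g$ are continuous. Projections. $\Pi(C)=\{x:\exists u_c\in\mathcal{U}_c,\ (x,u_c)\in C\}$, $\Pi(D)=\{x:\exists u_d\in\mathcal{U}_d,\ (x,u_d)\in D\}$; $\Psi_c(x)=\{u_c:(x,u_c)\in C\}$, $\Psi_d(x)=\{u_d:(x,u_d)\in D\}$ for $x\in\mathbb{R}^n$. A set-valued map $S:\mathbb{R}^n\rightrightarrows\mathbb{R}^m$ is lower semicontinuous if for each $x\in\mathbb{R}^n$, $\liminf_{x_i\to x}S(x_i)\supset S(x)$, where $\liminf_{x_i\to x}S(x_i)=\{z:\forall x_i\to x,\ \exists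 z_i\to z\text{ s.t. }z_i\in S(x_i)\}$. Control Lyapunov function (CLF). $|\cdot|$ is the Euclidean norm and $|x|_{\mathcal{A}}=\inf_{y\in\mathcal{A}}|x-y|$. Class $\mathcal{K}_\infty$: functions $[0,\infty)\to[0,\infty)$ that are continuous, zero at zero, strictly increasing and unbounded. A continuous function $V:\mathbb{R}^n\to\mathbb{R}$, continuously differentiable on an open set containing $\overline{\Pi(C)}$, is a CLF with $\mathcal{U}$ controls for $\mathcal{H}$ if there exist $\alpha_1,\alpha_2\in\mathcal{K}_\infty$ and a positive definite function $\alpha_3$ such that - $\alpha_1(|x|_{\mathcal{A}})\le V(x)\le\alpha_2(|x|_{\mathcal{A}})$ for all $x\in\Pi(C)\cup\Pi(D)\cup g(D)$; - $\inf_{u_c\in\Psi_c(x)}\langle\nabla V(x),f(x,u_c)\rangle\le-\alpha_3(|x|_{\mathcal{A}})$ for all $x\in\Pi(C)$; - $\inf_{u_d\in\Psi_d(x)}V(g(x,u_d))-V(x)\le-\alpha_3(|x|_{\mathcal{A}})$ for all $x\in\Pi(D)$. Derived objects (for the given $V$, $\alpha_3$). For $r\ge0$, $\mathcal{I}(r)=\{x\in\mathbb{R}^n:V(x)\ge r\}$. $\Gamma_c(x,u_c,r)=\langle\nabla V(x),f(x,u_c)\rangle+\alpha_3(|x|_{\mathcal{A}})$ if $(x,u_c)\in C\cap(\mathcal{I}(r)\times\mathbb{R}^{m_c})$, and $-\infty$ otherwise. $\Gamma_d(x,u_d,r)=V(g(x,u_d))-V(x)+\alpha_3(|x|_{\mathcal{A}})$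 if $(x,u_d)\in D\cap(\mathcal{I}(r)\times\mathbb{R}^{m_d})$, and $-\infty$ otherwise. $\Upsilon_c(x,u_c)=\Gamma_c(x,u_c,V(x))$, $\Upsilon_d(x,u_d)=\Gamma_d(x,u_d,V(x))$. $\mathcal{T}_c(x)=\Psi_c(x)\cap\{u_c\in\mathcal{U}_c:\Upsilon_c(x,u_c)\le0\}$, $\mathcal{T}_d(x)=\Psi_d(x)\cap\{u_d\in\mathcal{U}_d:\Upsilon_d(x,u_d)\le0\}$. $R_c=\Pi(C)\cap\{x:V(x)>0\}$, $R_d=\Pi(D)\cap\{x:V(x)>0\}$. Restricted system. For $r>0$, $\mathcal{H}_{\mathcal{I}}$ is the hybrid system with the same $f,g$ and with flow set $C\cap(\mathcal{I}(r)\times\mathbb{R}^{m_c})$ and jump set $D\cap(\mathcal{I}(r)\times\mathbb{R}^{m_d})$. Closed loop. Applying a feedback pair $(\rho_c,\rho_d)$ to a hybrid system with flow set $C'$ and jump set $D'$ gives $\dot x=f(x,\rho_c(x))$ for $x\in\{x:(x,\rho_c(x))\in C'\}$ and $x^+=g(x,\rho_d(x))$ for $x\in\{x:(x,\rho_d(x))\in D'\}$ ($x$ ranging over the domain of the respective feedback). Solutions. A hybrid time domain is a set $E\subset[0,\infty)\times\mathbb{N}$ such that for each $(T,J)\in E$, $E\cap([0,T]\times\{0,\dots,J\})=\bigcup_{j}([t_j,t_{j+1}],j)$ for a finite sequence $0=t_0\le t_1\le\cdots$. Solutions of the closed loop are functions $\phi$ on hybrid time domains, with $t\mapsto\phi(t,j)$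 absolutely continuous on $\{t:(t,j)\in\mathrm{dom}\,\phi\}$ for each $j$, satisfying the flow dynamics along each such interval and the jump dynamics at each jump. A solution is complete if its domain is unbounded and maximal if it is not a truncation of another solution to a proper subset of the latter's domain. Asymptotic stability. A compact set $K$ is asymptotically stable for a closed-loop system (a feedback "renders $K$ asymptotically stable") if: for each $\varepsilon>0$ there exists $\delta>0$ such that each maximal solution $\phi$ starting from $K+\delta\mathbb{B}$ satisfies $\phi(t,j)\in K+\varepsilon\mathbb{B}$ for each $(t,j)\in\mathrm{dom}\,\phi$; and each maximal solution is bounded and the complete ones satisfy $\lim_{t+j\to\infty}|\phi(t,j)|_K=0$. Here $\mathbb{B}$ is the closed unit ball.
   Formalization: Continuity of ρ_c, ρ_d also assumes that at each point of their domains some input has Υ<0 (true after halving α3); α3 is continuous; stability is for any laws attaining the argmin; A_r is shown compact unless C and D are both empty. *)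

theory Defs
  imports "HOL-Analysis.Analysis"
begin

section \<open>Hybrid systems with inputs\<close>

record ('x, 'uc, 'ud) hybrid_system =
  flow_set :: "('x \<times> 'uc) set"
  flow_map :: "'x \<times> 'uc \<Rightarrow> 'x"
  jump_set :: "('x \<times> 'ud) set"
  jump_map :: "'x \<times> 'ud \<Rightarrow> 'x"

text \<open>The flow and jump sets are closed relative to the state-input spaces; the input sets
  themselves need not be closed.\<close>

definition hybrid_basic_conditions ::
  "'uc set \<Rightarrow> 'ud set
    \<Rightarrow> ('x::euclidean_space, 'uc::euclidean_space, 'ud::euclidean_space) hybrid_system \<Rightarrow> bool" where
  "hybrid_basic_conditions Uc Ud H \<longleftrightarrow>
     closedin (top_of_set (UNIV \<times> Uc)) (flow_set H) \<and>
     closedin (top_of_set (UNIV \<times> Ud)) (jump_set H) \<and>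
     continuous_on UNIV (flow_map H) \<and> continuous_on UNIV (jump_map H)"

definition state_proj :: "'u set \<Rightarrow> ('x \<times> 'u) set \<Rightarrow> 'x set" where
  "state_proj U S = {x. \<exists>u\<in>U. (x, u) \<in> S}"

definition input_fiber :: "('x \<times> 'u) set \<Rightarrow> 'x \<Rightarrow> 'u set" where
  "input_fiber S x = {u. (x, u) \<in> S}"

section \<open>Set-valued maps\<close>

text \<open>The selections \<open>z i \<in> S (xs i)\<close> are required for every index, as in the formula for the
  inner limit used here, and not only for all large indices.\<close>

definition inner_limit :: "('x::topological_space \<Rightarrow> 'u::topological_space set) \<Rightarrow> 'x \<Rightarrow> 'u set" where
  "inner_limit S x =
     {z. \<forall>xs. xs \<longlonglongrightarrow> x \<longrightarrow> (\<exists>zs. zs \<longlonglongrightarrow> z \<and> (\<forall>i::nat. zs i \<in> S (xs i)))}"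

definition lower_semicontinuous_map ::
  "('x::topological_space \<Rightarrow> 'u::topological_space set) \<Rightarrow> bool" where
  "lower_semicontinuous_map S \<longleftrightarrow> (\<forall>x. S x \<subseteq> inner_limit S x)"

definition has_closed_graph :: "('x::topological_space \<Rightarrow> 'u::topological_space set) \<Rightarrow> bool" where
  "has_closed_graph S \<longleftrightarrow> closed {(x, u). u \<in> S x}"

text \<open>Analogue of \<open>convex_on\<close> for extended-real-valued functions.\<close>

definition ereal_convex_on :: "'a::real_vector set \<Rightarrow> ('a \<Rightarrow> ereal) \<Rightarrow> bool" where
  "ereal_convex_on S F \<longleftrightarrow> convex S \<and>
     (\<forall>x\<in>S. \<forall>y\<in>S. \<forall>u\<ge>0. \<forall>v\<ge>0. u + v = 1 \<longrightarrow>
        F (u *\<^sub>R x + v *\<^sub>R y) \<le> ereal u * F x + ereal v * F y)"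

section \<open>Control Lyapunov functions\<close>

text \<open>Comparison functions on \<open>[0, \<infinity>)\<close>; values at negative arguments are irrelevant.
  Positive definite functions are taken to be continuous, the usual convention
  for comparison functions.\<close>

definition class_K_infinity :: "(real \<Rightarrow> real) \<Rightarrow> bool" where
  "class_K_infinity \<alpha> \<longleftrightarrow> continuous_on {0..} \<alpha> \<and> \<alpha> 0 = 0 \<and> strict_mono_on {0..} \<alpha> \<and>
     (\<forall>M. \<exists>s\<ge>0. \<alpha> s > M)"

definition positive_definite_fun :: "(real \<Rightarrow> real) \<Rightarrow> bool" where
  "positive_definite_fun \<alpha> \<longleftrightarrow> continuous_on {0..} \<alpha> \<and> \<alpha> 0 = 0 \<and> (\<forall>s>0. \<alpha> s > 0)"

definition gradient :: "('x::euclidean_space \<Rightarrow> real) \<Rightarrow> 'x \<Rightarrow> 'x" where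
  "gradient V x = (THE d. GDERIV V x :> d)"

definition C1_on_open :: "('x::euclidean_space \<Rightarrow> real) \<Rightarrow> 'x set \<Rightarrow> bool" where
  "C1_on_open V W \<longleftrightarrow> open W \<and> (\<forall>x\<in>W. V differentiable (at x)) \<and> continuous_on W (gradient V)"

text \<open>\<open>V\<close> is a control Lyapunov function for \<open>H\<close> and \<open>A\<close> iff this holds for some
  \<open>\<alpha>1\<close>, \<open>\<alpha>2\<close>, \<open>\<alpha>3\<close>. The infima are extended-real because they may be \<open>-\<infinity>\<close>.\<close>

definition control_lyapunov_function ::
  "'x set \<Rightarrow> 'uc set \<Rightarrow> 'ud set
    \<Rightarrow> ('x::euclidean_space, 'uc::euclidean_space, 'ud::euclidean_space) hybrid_system
    \<Rightarrow> ('x \<Rightarrow> real) \<Rightarrow> (real \<Rightarrow> real) \<Rightarrow> (real \<Rightarrow> real) \<Rightarrow> (real \<Rightarrow> real) \<Rightarrow> bool" where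
  "control_lyapunov_function A Uc Ud H V \<alpha>1 \<alpha>2 \<alpha>3 \<longleftrightarrow>
     continuous_on UNIV V \<and>
     (\<exists>W. closure (state_proj Uc (flow_set H)) \<subseteq> W \<and> C1_on_open V W) \<and>
     class_K_infinity \<alpha>1 \<and> class_K_infinity \<alpha>2 \<and> positive_definite_fun \<alpha>3 \<and>
     (\<forall>x \<in> state_proj Uc (flow_set H) \<union> state_proj Ud (jump_set H) \<union> jump_map H ` jump_set H.
        \<alpha>1 (infdist x A) \<le> V x \<and> V x \<le> \<alpha>2 (infdist x A)) \<and>
     (\<forall>x \<in> state_proj Uc (flow_set H).
        (INF u\<in>input_fiber (flow_set H) x. ereal (gradient V x \<bullet> flow_map H (x, u)))
          \<le> ereal (- \<alpha>3 (infdist x A))) \<and>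
     (\<forall>x \<in> state_proj Ud (jump_set H).
        (INF u\<in>input_fiber (jump_set H) x. ereal (V (jump_map H (x, u)))) - ereal (V x)
          \<le> ereal (- \<alpha>3 (infdist x A)))"

definition superlevel :: "('x \<Rightarrow> real) \<Rightarrow> real \<Rightarrow> 'x set" where
  "superlevel V r = {x. V x \<ge> r}"

definition Gamma_c ::
  "'x set \<Rightarrow> ('x::euclidean_space, 'uc, 'ud) hybrid_system \<Rightarrow> ('x \<Rightarrow> real) \<Rightarrow> (real \<Rightarrow> real)
    \<Rightarrow> 'x \<Rightarrow> 'uc \<Rightarrow> real \<Rightarrow> ereal" where
  "Gamma_c A H V \<alpha>3 x u r =
     (if (x, u) \<in> flow_set H \<inter> (superlevel V r \<times> UNIV)
      then ereal (gradient V x \<bullet> flow_map H (x, u) + \<alpha>3 (infdist x A)) else -\<infinity>)"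

definition Gamma_d ::
  "'x set \<Rightarrow> ('x::euclidean_space, 'uc, 'ud) hybrid_system \<Rightarrow> ('x \<Rightarrow> real) \<Rightarrow> (real \<Rightarrow> real)
    \<Rightarrow> 'x \<Rightarrow> 'ud \<Rightarrow> real \<Rightarrow> ereal" where
  "Gamma_d A H V \<alpha>3 x u r =
     (if (x, u) \<in> jump_set H \<inter> (superlevel V r \<times> UNIV)
      then ereal (V (jump_map H (x, u)) - V x + \<alpha>3 (infdist x A)) else -\<infinity>)"

definition Upsilon_c ::
  "'x set \<Rightarrow> ('x::euclidean_space, 'uc, 'ud) hybrid_system \<Rightarrow> ('x \<Rightarrow> real) \<Rightarrow> (real \<Rightarrow> real)
    \<Rightarrow> 'x \<Rightarrow> 'uc \<Rightarrow> ereal" where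
  "Upsilon_c A H V \<alpha>3 x u = Gamma_c A H V \<alpha>3 x u (V x)"

definition Upsilon_d ::
  "'x set \<Rightarrow> ('x::euclidean_space, 'uc, 'ud) hybrid_system \<Rightarrow> ('x \<Rightarrow> real) \<Rightarrow> (real \<Rightarrow> real)
    \<Rightarrow> 'x \<Rightarrow> 'ud \<Rightarrow> ereal" where
  "Upsilon_d A H V \<alpha>3 x u = Gamma_d A H V \<alpha>3 x u (V x)"

definition T_c ::
  "'x set \<Rightarrow> 'uc set \<Rightarrow> ('x::euclidean_space, 'uc, 'ud) hybrid_system \<Rightarrow> ('x \<Rightarrow> real)
    \<Rightarrow> (real \<Rightarrow> real) \<Rightarrow> 'x \<Rightarrow> 'uc set" where
  "T_c A Uc H V \<alpha>3 x = input_fiber (flow_set H) x \<inter> {u\<in>Uc. Upsilon_c A H V \<alpha>3 x u \<le> 0}"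

definition T_d ::
  "'x set \<Rightarrow> 'ud set \<Rightarrow> ('x::euclidean_space, 'uc, 'ud) hybrid_system \<Rightarrow> ('x \<Rightarrow> real)
    \<Rightarrow> (real \<Rightarrow> real) \<Rightarrow> 'x \<Rightarrow> 'ud set" where
  "T_d A Ud H V \<alpha>3 x = input_fiber (jump_set H) x \<inter> {u\<in>Ud. Upsilon_d A H V \<alpha>3 x u \<le> 0}"

definition R_c :: "'uc set \<Rightarrow> ('x, 'uc, 'ud) hybrid_system \<Rightarrow> ('x \<Rightarrow> real) \<Rightarrow> 'x set" where
  "R_c Uc H V = state_proj Uc (flow_set H) \<inter> {x. V x > 0}"

definition R_d :: "'ud set \<Rightarrow> ('x, 'uc, 'ud) hybrid_system \<Rightarrow> ('x \<Rightarrow> real) \<Rightarrow> 'x set" where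
  "R_d Ud H V = state_proj Ud (jump_set H) \<inter> {x. V x > 0}"

definition min_norm_pair ::
  "'x set \<Rightarrow> 'uc set \<Rightarrow> 'ud set
    \<Rightarrow> ('x::euclidean_space, 'uc::euclidean_space, 'ud::euclidean_space) hybrid_system
    \<Rightarrow> ('x \<Rightarrow> real) \<Rightarrow> (real \<Rightarrow> real) \<Rightarrow> real \<Rightarrow> ('x \<Rightarrow> 'uc) \<Rightarrow> ('x \<Rightarrow> 'ud) \<Rightarrow> bool" where
  "min_norm_pair A Uc Ud H V \<alpha>3 r \<rho>c \<rho>d \<longleftrightarrow>
     (\<forall>x \<in> R_c Uc H V \<inter> superlevel V r. is_arg_min norm (\<lambda>u. u \<in> T_c A Uc H V \<alpha>3 x) (\<rho>c x)) \<and>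
     (\<forall>x \<in> R_d Ud H V \<inter> superlevel V r. is_arg_min norm (\<lambda>u. u \<in> T_d A Ud H V \<alpha>3 x) (\<rho>d x))"

text \<open>The infimum conditions on a control Lyapunov function only give \<open>Upsilon \<le> 0\<close> in the
  infimum. The following condition asks for inputs with strict inequality (a Slater condition
  for the convex constraints defining \<open>T_c\<close> and \<open>T_d\<close>). It always holds after \<open>\<alpha>3\<close> is halved,
  see \<open>control_lyapunov_function_half\<close>.\<close>

definition strictly_feasible ::
  "'x set \<Rightarrow> 'uc set \<Rightarrow> 'ud set
    \<Rightarrow> ('x::euclidean_space, 'uc::euclidean_space, 'ud::euclidean_space) hybrid_system
    \<Rightarrow> ('x \<Rightarrow> real) \<Rightarrow> (real \<Rightarrow> real) \<Rightarrow> real \<Rightarrow> bool" where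
  "strictly_feasible A Uc Ud H V \<alpha>3 r \<longleftrightarrow>
     (\<forall>x \<in> R_c Uc H V \<inter> superlevel V r.
        \<exists>u\<in>input_fiber (flow_set H) x. Upsilon_c A H V \<alpha>3 x u < 0) \<and>
     (\<forall>x \<in> R_d Ud H V \<inter> superlevel V r.
        \<exists>u\<in>input_fiber (jump_set H) x. Upsilon_d A H V \<alpha>3 x u < 0)"

definition restrict_system ::
  "('x \<Rightarrow> real) \<Rightarrow> real \<Rightarrow> ('x, 'uc, 'ud) hybrid_system \<Rightarrow> ('x, 'uc, 'ud) hybrid_system" where
  "restrict_system V r H =
     H\<lparr>flow_set := flow_set H \<inter> (superlevel V r \<times> UNIV),
       jump_set := jump_set H \<inter> (superlevel V r \<times> UNIV)\<rparr>"

section \<open>Closed-loop systems and their solutions\<close>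

record 'x autonomous_system =
  auto_flow_set :: "'x set"
  auto_flow_map :: "'x \<Rightarrow> 'x"
  auto_jump_set :: "'x set"
  auto_jump_map :: "'x \<Rightarrow> 'x"

text \<open>The feedback laws are total functions; \<open>Xc\<close> and \<open>Xd\<close> are their mathematical domains.\<close>

definition closed_loop ::
  "('x, 'uc, 'ud) hybrid_system \<Rightarrow> 'x set \<Rightarrow> ('x \<Rightarrow> 'uc) \<Rightarrow> 'x set \<Rightarrow> ('x \<Rightarrow> 'ud)
    \<Rightarrow> 'x autonomous_system" where
  "closed_loop H Xc \<rho>c Xd \<rho>d =
     \<lparr>auto_flow_set = {x\<in>Xc. (x, \<rho>c x) \<in> flow_set H}, auto_flow_map = (\<lambda>x. flow_map H (x, \<rho>c x)),
      auto_jump_set = {x\<in>Xd. (x, \<rho>d x) \<in> jump_set H}, auto_jump_map = (\<lambda>x. jump_map H (x, \<rho>d x))\<rparr>"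

definition hybrid_time_domain :: "(real \<times> nat) set \<Rightarrow> bool" where
  "hybrid_time_domain E \<longleftrightarrow> E \<subseteq> {0..} \<times> UNIV \<and>
     (\<forall>(T, J) \<in> E. \<exists>N t. t 0 = 0 \<and> (\<forall>j<N. t j \<le> t (Suc j)) \<and>
        E \<inter> ({0..T} \<times> {0..J}) = (\<Union>j<N. {t j..t (Suc j)} \<times> {j}))"

definition time_slice :: "(real \<times> nat) set \<Rightarrow> nat \<Rightarrow> real set" where
  "time_slice E j = {t. (t, j) \<in> E}"

definition absolutely_continuous_on_interval ::
  "real \<Rightarrow> real \<Rightarrow> (real \<Rightarrow> 'x::real_normed_vector) \<Rightarrow> bool" where
  "absolutely_continuous_on_interval a b h \<longleftrightarrow>
     (\<forall>\<epsilon>>0. \<exists>\<delta>>0. \<forall>(n::nat) l u.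
        (\<forall>i<n. a \<le> l i \<and> l i \<le> u i \<and> u i \<le> b) \<and>
        (\<forall>i<n. \<forall>k<n. i \<noteq> k \<longrightarrow> {l i<..<u i} \<inter> {l k<..<u k} = {}) \<and>
        (\<Sum>i<n. u i - l i) < \<delta>
        \<longrightarrow> (\<Sum>i<n. norm (h (u i) - h (l i))) < \<epsilon>)"

text \<open>On a time slice that is not compact, absolute continuity is understood on each compact
  subinterval. Flows satisfy the flow constraint on the interior of a time slice
  and the differential equation almost everywhere.\<close>

definition hybrid_solution ::
  "'x::euclidean_space autonomous_system \<Rightarrow> (real \<times> nat) set \<Rightarrow> (real \<Rightarrow> nat \<Rightarrow> 'x) \<Rightarrow> bool" where
  "hybrid_solution S E \<phi> \<longleftrightarrow> hybrid_time_domain E \<and> (0, 0) \<in> E \<and>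
     (\<forall>j a b. a \<le> b \<and> {a..b} \<subseteq> time_slice E j \<longrightarrow>
        absolutely_continuous_on_interval a b (\<lambda>t. \<phi> t j)) \<and>
     (\<forall>j. \<forall>t \<in> interior (time_slice E j). \<phi> t j \<in> auto_flow_set S) \<and>
     (\<forall>j. AE t in lebesgue. t \<in> interior (time_slice E j) \<longrightarrow>
        ((\<lambda>s. \<phi> s j) has_vector_derivative auto_flow_map S (\<phi> t j)) (at t)) \<and>
     (\<forall>t j. (t, j) \<in> E \<and> (t, Suc j) \<in> E \<longrightarrow>
        \<phi> t j \<in> auto_jump_set S \<and> \<phi> t (Suc j) = auto_jump_map S (\<phi> t j))"

definition maximal_solution ::
  "'x::euclidean_space autonomous_system \<Rightarrow> (real \<times> nat) set \<Rightarrow> (real \<Rightarrow> nat \<Rightarrow> 'x) \<Rightarrow> bool" where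
  "maximal_solution S E \<phi> \<longleftrightarrow> hybrid_solution S E \<phi> \<and>
     \<not> (\<exists>E' \<phi>'. hybrid_solution S E' \<phi>' \<and> E \<subset> E' \<and> (\<forall>(t, j) \<in> E. \<phi>' t j = \<phi> t j))"

definition complete_domain :: "(real \<times> nat) set \<Rightarrow> bool" where
  "complete_domain E \<longleftrightarrow> (\<forall>M. \<exists>(t, j) \<in> E. t + real j > M)"

definition asymptotically_stable ::
  "'x::euclidean_space autonomous_system \<Rightarrow> 'x set \<Rightarrow> bool" where
  "asymptotically_stable S K \<longleftrightarrow>
     (\<forall>\<epsilon>>0. \<exists>\<delta>>0. \<forall>E \<phi>.
        maximal_solution S E \<phi> \<and> \<phi> 0 0 \<in> {x + y |x y. x \<in> K \<and> y \<in> cball 0 \<delta>} \<longrightarrow>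
        (\<forall>(t, j) \<in> E. \<phi> t j \<in> {x + y |x y. x \<in> K \<and> y \<in> cball 0 \<epsilon>})) \<and>
     (\<forall>E \<phi>. maximal_solution S E \<phi> \<longrightarrow>
        bounded {\<phi> t j |t j. (t, j) \<in> E} \<and>
        (complete_domain E \<longrightarrow>
          (\<forall>\<epsilon>>0. \<exists>N. \<forall>(t, j) \<in> E. t + real j \<ge> N \<longrightarrow> infdist (\<phi> t j) K < \<epsilon>)))"

section \<open>Strict feasibility for the halved decrease rate\<close>

lemma control_lyapunov_function_half:
  assumes clf: "control_lyapunov_function A Uc Ud H V \<alpha>1 \<alpha>2 \<alpha>3"
  shows "control_lyapunov_function A Uc Ud H V \<alpha>1 \<alpha>2 (\<lambda>s. \<alpha>3 s / 2)"
    and "strictly_feasible A Uc Ud H V (\<lambda>s. \<alpha>3 s / 2) r"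
proof -
  have pd: "positive_definite_fun \<alpha>3"
    using clf unfolding control_lyapunov_function_def by blast
  have nonneg: "0 \<le> \<alpha>3 (infdist x A)" for x
    using pd infdist_nonneg[of x A] unfolding positive_definite_fun_def
    by (metis less_eq_real_def)
  have pd2: "positive_definite_fun (\<lambda>s. \<alpha>3 s / 2)"
    using pd unfolding positive_definite_fun_def by (auto intro!: continuous_intros)
  have le: "ereal (- \<alpha>3 (infdist x A)) \<le> ereal (- (\<alpha>3 (infdist x A) / 2))" for x
    using nonneg[of x] by simp
  show "control_lyapunov_function A Uc Ud H V \<alpha>1 \<alpha>2 (\<lambda>s. \<alpha>3 s / 2)"
    using clf pd2 le unfolding control_lyapunov_function_def by (meson order_trans)
  have pos: "0 < \<alpha>3 (infdist x A)"
    if "x \<in> state_proj Uc (flow_set H) \<union> state_proj Ud (jump_set H)" "V x > 0" for x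
  proof -
    have "V x \<le> \<alpha>2 (infdist x A)" "\<alpha>2 0 = 0"
      using clf that(1) unfolding control_lyapunov_function_def class_K_infinity_def by blast+
    then have "infdist x A \<noteq> 0" using that(2) by auto
    then show ?thesis
      using pd infdist_nonneg[of x A] unfolding positive_definite_fun_def by simp
  qed
  have flow: "\<exists>u\<in>input_fiber (flow_set H) x. Upsilon_c A H V (\<lambda>s. \<alpha>3 s / 2) x u < 0"
    if "x \<in> R_c Uc H V" for x
  proof -
    have x: "x \<in> state_proj Uc (flow_set H)" "V x > 0" using that by (auto simp: R_c_def)
    have "(INF u\<in>input_fiber (flow_set H) x. ereal (gradient V x \<bullet> flow_map H (x, u)))
            \<le> ereal (- \<alpha>3 (infdist x A))"
      using clf x(1) unfolding control_lyapunov_function_def by blast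
    also have "\<dots> < ereal (- \<alpha>3 (infdist x A) / 2)" using pos[of x] x by simp
    finally obtain u where u: "u \<in> input_fiber (flow_set H) x"
      "ereal (gradient V x \<bullet> flow_map H (x, u)) < ereal (- \<alpha>3 (infdist x A) / 2)"
      unfolding INF_less_iff by blast
    then have "Upsilon_c A H V (\<lambda>s. \<alpha>3 s / 2) x u < 0"
      by (simp add: Upsilon_c_def Gamma_c_def superlevel_def input_fiber_def)
    then show ?thesis using u(1) by blast
  qed
  have jump: "\<exists>u\<in>input_fiber (jump_set H) x. Upsilon_d A H V (\<lambda>s. \<alpha>3 s / 2) x u < 0"
    if "x \<in> R_d Ud H V" for x
  proof -
    have x: "x \<in> state_proj Ud (jump_set H)" "V x > 0" using that by (auto simp: R_d_def)
    let ?I = "INF u\<in>input_fiber (jump_set H) x. ereal (V (jump_map H (x, u)))"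
    have "?I - ereal (V x) \<le> ereal (- \<alpha>3 (infdist x A))"
      using clf x(1) unfolding control_lyapunov_function_def by blast
    then have "?I \<le> ereal (V x - \<alpha>3 (infdist x A))"
      by (cases ?I) (auto simp: algebra_simps)
    also have "\<dots> < ereal (V x - \<alpha>3 (infdist x A) / 2)" using pos[of x] x by simp
    finally obtain u where u: "u \<in> input_fiber (jump_set H) x"
      "ereal (V (jump_map H (x, u))) < ereal (V x - \<alpha>3 (infdist x A) / 2)"
      unfolding INF_less_iff by blast
    then have "Upsilon_d A H V (\<lambda>s. \<alpha>3 s / 2) x u < 0"
      by (simp add: Upsilon_d_def Gamma_d_def superlevel_def input_fiber_def)
    then show ?thesis using u(1) by blast
  qed
  show "strictly_feasible A Uc Ud H V (\<lambda>s. \<alpha>3 s / 2) r"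
    unfolding strictly_feasible_def using flow jump by blast
qed

end

theory Submission
  imports Defs
begin

text \<open>
  A map that is lower semicontinuous in the sense used here is empty everywhere or nowhere
  (\<open>lower_semicontinuous_map_nonempty\<close>). Hence each of the flow and jump sets is empty or projects
  onto the whole state space. If both are empty, solutions do not move and the feedback laws have
  empty domains.
  Otherwise the comparison bounds between \<open>V\<close> and the distance to \<open>A\<close> hold at every state, so \<open>V\<close> is
  nonnegative with compact sublevel sets, and if there is any flow then \<open>V\<close> is continuously
  differentiable on the whole space.

  Stability. A minimal-norm input is in particular an element of \<open>T_c\<close> or \<open>T_d\<close>, so along the closed loop \<open>V\<close>
  decreases at least at the rate \<open>\<alpha>3\<close> of the distance to \<open>A\<close>. The restricted system moves only where \<open>V \<ge> r\<close>.
  On the compact set where \<open>V\<close> lies between \<open>r\<close> and its initial value this rate has a lower bound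
  \<open>c > 0\<close>, which gives \<open>V (\<phi> t j) + c * (t + j) \<le> V (\<phi> 0 0)\<close>. Solutions therefore have bounded time
  domains, attractivity is vacuous, and stability is a consequence of the monotonicity of \<open>V\<close>
  (\<open>asymptotically_stable_sublevel\<close>). The analytic core is the decrease during flows, where a
  solution is only absolutely continuous and satisfies its differential equation almost everywhere
  (\<open>absolutely_continuous_nonincreasing\<close>).

  Regularity. The feasible inputs at a state form a closed convex set, which is nonempty under strict
  feasibility and thus has a unique element of minimal norm. The continuity of this element
  (\<open>min_norm_selection_continuous\<close>) combines lower semicontinuity and strict feasibility, which bound the
  norms of nearby minimisers from above, with the closed graph, which makes their limits feasible.
\<close>

section \<open>Absolutely continuous functions\<close>

text \<open>Families of intervals produced by tagged divisions come as finite sets rather than as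
  sequences; enumerating them reduces this form to the definition.\<close>

lemma absolutely_continuous_finite_family:
  assumes "absolutely_continuous_on_interval a b h" and "\<epsilon> > 0"
  obtains \<delta> where "\<delta> > 0"
    and "\<And>(I :: 'i set) l u. \<lbrakk>finite I; \<And>i. i \<in> I \<Longrightarrow> a \<le> l i \<and> l i \<le> u i \<and> u i \<le> b;
           disjoint_family_on (\<lambda>i. {l i<..<u i}) I; (\<Sum>i\<in>I. u i - l i) < \<delta>\<rbrakk>
           \<Longrightarrow> (\<Sum>i\<in>I. norm (h (u i) - h (l i))) < \<epsilon>"
proof -
  obtain \<delta> where "\<delta> > 0" and \<delta>: "\<And>(n::nat) l u.
        (\<forall>i<n. a \<le> l i \<and> l i \<le> u i \<and> u i \<le> b) \<and>
        (\<forall>i<n. \<forall>k<n. i \<noteq> k \<longrightarrow> {l i<..<u i} \<inter> {l k<..<u k} = {}) \<and>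
        (\<Sum>i<n. u i - l i) < \<delta> \<Longrightarrow> (\<Sum>i<n. norm (h (u i) - h (l i))) < \<epsilon>"
    using assms(1)[unfolded absolutely_continuous_on_interval_def, rule_format, OF assms(2)] by blast
  show thesis
  proof (rule that[OF \<open>\<delta> > 0\<close>])
    fix I :: "'i set" and l u
    assume fin: "finite I" and sub: "\<And>i. i \<in> I \<Longrightarrow> a \<le> l i \<and> l i \<le> u i \<and> u i \<le> b"
      and dis: "disjoint_family_on (\<lambda>i. {l i<..<u i}) I" and small: "(\<Sum>i\<in>I. u i - l i) < \<delta>"
    obtain f where f: "bij_betw f {..<card I} I"
      using ex_bij_betw_nat_finite[OF fin] by (auto simp: atLeast0LessThan)
    have mem: "f i \<in> I" if "i < card I" for i
      using f that bij_betwE by blast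
    have "{l (f i)<..<u (f i)} \<inter> {l (f k)<..<u (f k)} = {}"
      if "i < card I" "k < card I" "i \<noteq> k" for i k
    proof -
      have "f i \<noteq> f k"
        using f that by (auto simp: bij_betw_def inj_on_def)
      then show ?thesis
        using disjoint_family_onD[OF dis] mem that by blast
    qed
    moreover have "(\<Sum>i<card I. u (f i) - l (f i)) < \<delta>"
      using sum.reindex_bij_betw[OF f, of "\<lambda>i. u i - l i"] small by simp
    ultimately have "(\<Sum>i<card I. norm (h (u (f i)) - h (l (f i)))) < \<epsilon>"
      using \<delta>[of "card I" "\<lambda>i. l (f i)" "\<lambda>i. u (f i)"] sub mem by blast
    then show "(\<Sum>i\<in>I. norm (h (u i) - h (l i))) < \<epsilon>"
      using sum.reindex_bij_betw[OF f, of "\<lambda>i. norm (h (u i) - h (l i))"] by simp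
  qed
qed

text \<open>The extra term \<open>v - u\<close> in the bound covers adding a linear function of time, so that one
  application handles \<open>t \<mapsto> V (x t) + c * t\<close>.\<close>

lemma absolutely_continuous_dominated:
  assumes h: "absolutely_continuous_on_interval a b h"
    and dom: "\<And>u v. \<lbrakk>a \<le> u; u \<le> v; v \<le> b\<rbrakk> \<Longrightarrow> norm (k v - k u) \<le> L * (norm (h v - h u) + (v - u))"
    and "L > 0"
  shows "absolutely_continuous_on_interval a b k"
  unfolding absolutely_continuous_on_interval_def
proof (intro allI impI)
  fix \<epsilon> :: real assume "\<epsilon> > 0"
  define \<eta> where "\<eta> = \<epsilon> / (2 * L)"
  have "\<eta> > 0" using \<open>\<epsilon> > 0\<close> \<open>L > 0\<close> by (simp add: \<eta>_def)
  obtain \<delta> where "\<delta> > 0" and \<delta>: "\<And>(I :: nat set) l u. \<lbrakk>finite I;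
           \<And>i. i \<in> I \<Longrightarrow> a \<le> l i \<and> l i \<le> u i \<and> u i \<le> b;
           disjoint_family_on (\<lambda>i. {l i<..<u i}) I; (\<Sum>i\<in>I. u i - l i) < \<delta>\<rbrakk>
           \<Longrightarrow> (\<Sum>i\<in>I. norm (h (u i) - h (l i))) < \<eta>"
    using absolutely_continuous_finite_family[OF h \<open>\<eta> > 0\<close>, where ?'i = nat] by blast
  show "\<exists>\<delta>>0. \<forall>(n::nat) l u.
        (\<forall>i<n. a \<le> l i \<and> l i \<le> u i \<and> u i \<le> b) \<and>
        (\<forall>i<n. \<forall>k<n. i \<noteq> k \<longrightarrow> {l i<..<u i} \<inter> {l k<..<u k} = {}) \<and>
        (\<Sum>i<n. u i - l i) < \<delta> \<longrightarrow> (\<Sum>i<n. norm (k (u i) - k (l i))) < \<epsilon>"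
  proof (intro exI[of _ "min \<delta> \<eta>"] conjI allI impI)
    show "min \<delta> \<eta> > 0" using \<open>\<delta> > 0\<close> \<open>\<eta> > 0\<close> by simp
    fix n :: nat and l u :: "nat \<Rightarrow> real"
    assume *: "(\<forall>i<n. a \<le> l i \<and> l i \<le> u i \<and> u i \<le> b) \<and>
        (\<forall>i<n. \<forall>k<n. i \<noteq> k \<longrightarrow> {l i<..<u i} \<inter> {l k<..<u k} = {}) \<and>
        (\<Sum>i<n. u i - l i) < min \<delta> \<eta>"
    then have hs: "(\<Sum>i<n. norm (h (u i) - h (l i))) < \<eta>"
      by (intro \<delta>) (auto simp: disjoint_family_on_def)
    have "(\<Sum>i<n. norm (k (u i) - k (l i)))
            \<le> (\<Sum>i<n. L * (norm (h (u i) - h (l i)) + (u i - l i)))"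
      using * by (intro sum_mono dom) auto
    also have "\<dots> = L * ((\<Sum>i<n. norm (h (u i) - h (l i))) + (\<Sum>i<n. u i - l i))"
      by (simp only: sum_distrib_left[symmetric] sum.distrib)
    also have "\<dots> < L * (\<eta> + \<eta>)"
      using hs * \<open>L > 0\<close> by (intro mult_strict_left_mono add_strict_mono) auto
    also have "\<dots> = \<epsilon>"
      using \<open>L > 0\<close> by (simp add: \<eta>_def field_simps)
    finally show "(\<Sum>i<n. norm (k (u i) - k (l i))) < \<epsilon>" .
  qed
qed

lemma absolutely_continuous_imp_continuous_on:
  assumes "absolutely_continuous_on_interval a b h"
  shows "continuous_on {a..b} h"
  unfolding continuous_on_iff
proof (intro ballI allI impI)
  fix x \<epsilon> :: real assume x: "x \<in> {a..b}" and "\<epsilon> > 0"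
  obtain \<delta> where "\<delta> > 0" and \<delta>: "\<And>(I :: unit set) l u. \<lbrakk>finite I;
           \<And>i. i \<in> I \<Longrightarrow> a \<le> l i \<and> l i \<le> u i \<and> u i \<le> b;
           disjoint_family_on (\<lambda>i. {l i<..<u i}) I; (\<Sum>i\<in>I. u i - l i) < \<delta>\<rbrakk>
           \<Longrightarrow> (\<Sum>i\<in>I. norm (h (u i) - h (l i))) < \<epsilon>"
    using absolutely_continuous_finite_family[OF assms \<open>\<epsilon> > 0\<close>, where ?'i = unit] by blast
  have "dist (h y) (h x) < \<epsilon>" if y: "y \<in> {a..b}" "dist y x < \<delta>" for y
  proof -
    have "norm (h (max x y) - h (min x y)) < \<epsilon>"
      using \<delta>[of "{()}" "\<lambda>_. min x y" "\<lambda>_. max x y"] x y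
      by (auto simp: disjoint_family_on_def dist_real_def abs_if split: if_splits)
    then show ?thesis
      by (cases "x \<le> y") (auto simp: dist_norm norm_minus_commute min_def max_def)
  qed
  with \<open>\<delta> > 0\<close> show "\<exists>\<delta>>0. \<forall>y\<in>{a..b}. dist y x < \<delta> \<longrightarrow> dist (h y) (h x) < \<epsilon>"
    by blast
qed

lemma null_set_open_cover:
  fixes N :: "real set"
  assumes "negligible N" and "\<delta> > 0"
  obtains G where "open G" "N \<subseteq> G" "emeasure lebesgue G < ennreal \<delta>"
proof -
  have N: "N \<in> null_sets lebesgue"
    using assms negligible_iff_null_sets by blast
  then obtain G where G: "open G" "N \<subseteq> G" "G - N \<in> lmeasurable"
      "emeasure lebesgue (G - N) < ennreal \<delta>"
    using sets_lebesgue_outer_open[of N \<delta>] \<open>\<delta> > 0\<close> by blast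
  have "emeasure lebesgue (G - N) = emeasure lebesgue G"
    using N G(1) by (intro emeasure_Diff_null_set) auto
  with G that show thesis by simp
qed

text \<open>A sign condition on the derivative that holds only almost everywhere suffices
  because of absolute continuity. For a tagged division that is fine for a suitable gauge, the
  increments over intervals tagged outside the null set \<open>N\<close> are at most \<open>e\<close> times their
  length, while the intervals tagged in \<open>N\<close> lie in an open set of measure below \<open>\<delta>\<close> and
  therefore contribute less than \<open>e\<close> in total. The increments add up to \<open>h b - h a\<close>.\<close>

lemma absolutely_continuous_nonincreasing:
  fixes h :: "real \<Rightarrow> real"
  assumes "a \<le> b" and ac: "absolutely_continuous_on_interval a b h" and N: "negligible N"
    and deriv: "\<And>t. t \<in> {a..b} - N \<Longrightarrow> \<exists>D\<le>0. (h has_real_derivative D) (at t within {a..b})"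
  shows "h b \<le> h a"
proof (rule field_le_epsilon)
  fix \<epsilon> :: real assume "\<epsilon> > 0"
  \<comment> \<open>The two groups of intervals contribute \<open>e * (b - a)\<close> and \<open>e\<close>.\<close>
  define e where "e = \<epsilon> / (b - a + 1)"
  have "e > 0" and e: "e * (b - a) + e = \<epsilon>"
  proof -
    have "e * (b - a + 1) = \<epsilon>" using \<open>a \<le> b\<close> by (simp add: e_def)
    then show "e * (b - a) + e = \<epsilon>" by (simp add: distrib_left)
  qed (use \<open>\<epsilon> > 0\<close> \<open>a \<le> b\<close> in \<open>simp add: e_def\<close>)
  obtain \<delta> where "\<delta> > 0" and \<delta>: "\<And>(I :: (real \<times> real set) set) l u. \<lbrakk>finite I;
           \<And>i. i \<in> I \<Longrightarrow> a \<le> l i \<and> l i \<le> u i \<and> u i \<le> b;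
           disjoint_family_on (\<lambda>i. {l i<..<u i}) I; (\<Sum>i\<in>I. u i - l i) < \<delta>\<rbrakk>
           \<Longrightarrow> (\<Sum>i\<in>I. norm (h (u i) - h (l i))) < e"
    using absolutely_continuous_finite_family[OF ac \<open>e > 0\<close>, where ?'i = "real \<times> real set"]
    by blast
  obtain G where G: "open G" "N \<subseteq> G" "emeasure lebesgue G < ennreal \<delta>"
    using null_set_open_cover[OF N \<open>\<delta> > 0\<close>] .
  have "\<exists>d>0. \<forall>u v. u \<le> t \<and> t \<le> v \<and> {u..v} \<subseteq> {a..b} \<inter> ball t d \<longrightarrow> h v - h u \<le> e * (v - u)"
    if t: "t \<in> {a..b} - N" for t
  proof -
    obtain D where "D \<le> 0" and D: "(h has_real_derivative D) (at t within {a..b})"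
      using deriv[OF t] by blast
    then obtain d where "d > 0"
      and d: "\<And>y. y \<in> {a..b} \<Longrightarrow> \<bar>y - t\<bar> < d \<Longrightarrow> \<bar>h y - h t - D * (y - t)\<bar> \<le> e * \<bar>y - t\<bar>"
      using \<open>e > 0\<close> unfolding has_field_derivative_def has_derivative_within_alt real_norm_def
      by (metis (no_types, lifting))
    have "h v - h u \<le> e * (v - u)" if "u \<le> t" "t \<le> v" "{u..v} \<subseteq> {a..b} \<inter> ball t d" for u v
    proof -
      have "u \<in> {u..v}" "v \<in> {u..v}" using that by auto
      then have uv: "u \<in> {a..b}" "v \<in> {a..b}" "\<bar>u - t\<bar> < d" "\<bar>v - t\<bar> < d"
        using that(3) by (auto simp: dist_real_def abs_minus_commute)
      have "h v - h t \<le> D * (v - t) + e * (v - t)" "h t - h u \<le> D * (t - u) + e * (t - u)"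
        using d[of v] d[of u] uv that(1,2) by (auto simp: algebra_simps abs_le_iff)
      moreover have "D * (v - t) \<le> 0" "D * (t - u) \<le> 0"
        using \<open>D \<le> 0\<close> that by (auto simp: mult_nonpos_nonneg)
      ultimately show ?thesis by (simp add: algebra_simps)
    qed
    with \<open>d > 0\<close> show ?thesis by blast
  qed
  then obtain d where d: "\<And>t. t \<in> {a..b} - N \<Longrightarrow> d t > 0"
    and dd: "\<And>t u v. \<lbrakk>t \<in> {a..b} - N; u \<le> t; t \<le> v; {u..v} \<subseteq> {a..b} \<inter> ball t (d t)\<rbrakk>
               \<Longrightarrow> h v - h u \<le> e * (v - u)"
    by metis
  \<comment> \<open>Tags outside \<open>N\<close> are controlled by the derivative; intervals with a tag in \<open>N\<close> are kept
    inside the open set \<open>G\<close>, so that their total length is below \<open>\<delta>\<close>.\<close>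
  define g where "g = (\<lambda>t. if t \<in> N then G else if t \<in> {a..b} then ball t (d t) else ball t 1)"
  have "gauge g"
    using G d by (auto simp: gauge_def g_def)
  then obtain p where p: "p tagged_division_of {a..b}" and fine: "g fine p"
    using fine_division_exists_real by blast
  define P where "P = {(x, K) \<in> p. x \<in> N}"
  define lo hi where "lo = (\<lambda>z::real \<times> real set. Inf (snd z))"
    and "hi = (\<lambda>z::real \<times> real set. Sup (snd z))"
  have "finite p" using p by blast
  have fin: "finite P" "P \<subseteq> p"
    using \<open>finite p\<close> by (auto simp: P_def intro: finite_subset)
  have K: "a \<le> lo z \<and> lo z \<le> fst z \<and> fst z \<le> hi z \<and> hi z \<le> b \<and> snd z = {lo z..hi z}
             \<and> {lo z..hi z} \<subseteq> g (fst z)"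
    if "z \<in> p" for z
  proof -
    obtain x K where z: "z = (x, K)" by force
    with that have "(x, K) \<in> p" by simp
    then obtain l u where "x \<in> K" "K \<subseteq> {a..b}" "K = {l..u}" "K \<subseteq> g x"
      using tagged_division_ofD[OF p] fine unfolding fine_def by (metis (no_types, lifting) box_real(2) case_prodD)
    then show ?thesis by (auto simp: z lo_def hi_def)
  qed
  have sum1: "(\<Sum>z\<in>p. hi z - lo z) = b - a"
    using additive_tagged_division_1[OF \<open>a \<le> b\<close> p, of "\<lambda>x. x"]
    by (simp add: lo_def hi_def case_prod_beta)
  have sumh: "(\<Sum>z\<in>p. h (hi z) - h (lo z)) = h b - h a"
    using additive_tagged_division_1[OF \<open>a \<le> b\<close> p, of h]
    by (simp add: lo_def hi_def case_prod_beta)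
  have dis: "disjoint_family_on (\<lambda>z. {lo z<..<hi z}) P"
    unfolding disjoint_family_on_def
  proof (intro ballI impI)
    fix z w assume zw: "z \<in> P" "w \<in> P" "z \<noteq> w"
    then have "interior (snd z) \<inter> interior (snd w) = {}"
      using tagged_division_ofD(5)[OF p, of "fst z" "snd z" "fst w" "snd w"] fin(2) by auto
    moreover have "snd z = {lo z..hi z}" "snd w = {lo w..hi w}"
      using K zw fin(2) by blast+
    ultimately show "{lo z<..<hi z} \<inter> {lo w<..<hi w} = {}"
      by (metis interior_atLeastAtMost_real)
  qed
  have "(\<Sum>z\<in>P. hi z - lo z) < \<delta>"
  proof -
    have len: "0 \<le> hi z - lo z" if "z \<in> P" for z
      using K[of z] fin(2) that by (auto simp: P_def)
    have meas: "G \<in> sets lebesgue"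
      using G(1) by auto
    have "ennreal (\<Sum>z\<in>P. hi z - lo z) = (\<Sum>z\<in>P. emeasure lebesgue {lo z<..<hi z})"
      using len by (simp flip: sum_ennreal)
    also have "\<dots> = emeasure lebesgue (\<Union>z\<in>P. {lo z<..<hi z})"
      using fin dis by (intro sum_emeasure) auto
    also have "\<dots> \<le> emeasure lebesgue G"
    proof (rule emeasure_mono[OF _ meas], rule UN_least)
      fix z assume "z \<in> P"
      then have "z \<in> p" "fst z \<in> N" by (auto simp: P_def)
      then have "{lo z..hi z} \<subseteq> G" using K[of z] by (simp add: g_def)
      then show "{lo z<..<hi z} \<subseteq> G" by force
    qed
    also have "\<dots> < ennreal \<delta>" by fact
    finally show ?thesis
      by (rule ennreal_less_iff[THEN iffD1, rotated]) (use len in \<open>auto intro: sum_nonneg\<close>)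
  qed
  then have "(\<Sum>z\<in>P. norm (h (hi z) - h (lo z))) < e"
    using K fin dis by (intro \<delta>) (fastforce)+
  moreover have "(\<Sum>z\<in>P. h (hi z) - h (lo z)) \<le> (\<Sum>z\<in>P. norm (h (hi z) - h (lo z)))"
    by (rule sum_mono) auto
  ultimately have bad: "(\<Sum>z\<in>P. h (hi z) - h (lo z)) < e" by linarith
  have "(\<Sum>z\<in>p-P. h (hi z) - h (lo z)) \<le> (\<Sum>z\<in>p-P. e * (hi z - lo z))"
  proof (rule sum_mono)
    fix z assume z: "z \<in> p - P"
    then have Kz: "a \<le> lo z \<and> lo z \<le> fst z \<and> fst z \<le> hi z \<and> hi z \<le> b \<and> {lo z..hi z} \<subseteq> g (fst z)"
      and "fst z \<notin> N"
      using K[of z] by (auto simp: P_def)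
    then show "h (hi z) - h (lo z) \<le> e * (hi z - lo z)"
      by (intro dd[of "fst z"]) (auto simp: g_def)
  qed
  also have "\<dots> \<le> (\<Sum>z\<in>p. e * (hi z - lo z))"
    using K \<open>e > 0\<close> by (intro sum_mono2[OF \<open>finite p\<close>]) force+
  also have "\<dots> = e * (b - a)"
    by (simp add: sum_distrib_left[symmetric] sum1)
  finally have "h b - h a \<le> e * (b - a) + e"
    using bad sum.subset_diff[OF fin(2) \<open>finite p\<close>, of "\<lambda>z. h (hi z) - h (lo z)"] sumh by simp
  then show "h b \<le> h a + \<epsilon>" using e by simp
qed

section \<open>Decrease of a function along solutions\<close>

text \<open>Existence of a gradient vector is the representation of a linear functional by an inner
  product, here with the vector \<open>adjoint F 1\<close>.\<close>

lemma GDERIV_imp_gradient: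
  assumes "V differentiable (at x)"
  shows "GDERIV V x :> gradient V x"
proof -
  obtain F where F: "(V has_derivative F) (at x)"
    using assms unfolding differentiable_def by blast
  then have "linear F" by (rule has_derivative_linear)
  define g where "g = adjoint F 1"
  have "F = (\<lambda>h. h \<bullet> g)"
    using adjoint_works[OF \<open>linear F\<close>, of _ 1] by (auto simp: g_def)
  with F have D: "GDERIV V x :> g"
    by (simp add: gderiv_def)
  have "d = g" if "GDERIV V x :> d" for d
  proof -
    have "(\<lambda>h. h \<bullet> d) = (\<lambda>h. h \<bullet> g)"
      using has_derivative_unique[OF that[unfolded gderiv_def] D[unfolded gderiv_def]] .
    then show ?thesis by (simp add: fun_eq_iff vector_eq_ldot)
  qed
  with D show ?thesis
    unfolding gradient_def by (rule theI[where P = "\<lambda>d. GDERIV V x :> d"])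
qed

lemma C1_lipschitz_on_cball:
  assumes V: "C1_on_open V UNIV"
  obtains L where "\<And>x y. \<lbrakk>x \<in> cball 0 R; y \<in> cball 0 R\<rbrakk> \<Longrightarrow> \<bar>V x - V y\<bar> \<le> L * norm (x - y)"
proof -
  have "continuous_on (cball 0 R) (gradient V)"
    using V continuous_on_subset unfolding C1_on_open_def by blast
  then have "bounded (gradient V ` cball 0 R)"
    by (intro compact_imp_bounded compact_continuous_image compact_cball)
  then obtain L where L: "norm (gradient V x) \<le> L" if "x \<in> cball 0 R" for x
    unfolding bounded_iff by blast
  have "norm (V x - V y) \<le> L * norm (x - y)" if "x \<in> cball 0 R" "y \<in> cball 0 R" for x y
  proof (rule differentiable_bound[where S = "cball 0 R" and f' = "\<lambda>z h. h \<bullet> gradient V z"])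
    fix z assume z: "z \<in> cball (0::'a) R"
    show "(V has_derivative (\<lambda>h. h \<bullet> gradient V z)) (at z within cball 0 R)"
      using V GDERIV_imp_gradient[of V z] unfolding C1_on_open_def gderiv_def
      by (auto intro: has_derivative_at_withinI)
    show "onorm (\<lambda>h. h \<bullet> gradient V z) \<le> L"
    proof (rule onorm_le)
      fix h
      have "norm (h \<bullet> gradient V z) \<le> norm h * norm (gradient V z)"
        by (simp add: Cauchy_Schwarz_ineq2)
      also have "\<dots> \<le> norm h * L"
        using L[OF z] by (intro mult_left_mono) auto
      finally show "norm (h \<bullet> gradient V z) \<le> L * norm h"
        by (simp add: mult.commute)
    qed
  qed (use that in auto)
  then show thesis by (rule that[of L, unfolded real_norm_def[symmetric]])
qed

text \<open>The solution stays in a ball on this compact time interval, and \<open>V\<close> is Lipschitz there.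
  Hence \<open>t \<mapsto> V (x t) + c * t\<close> is absolutely continuous, and by the chain rule its derivative is
  at most \<open>0\<close> almost everywhere.\<close>

lemma decrease_along_flow:
  fixes V :: "'x::euclidean_space \<Rightarrow> real"
  assumes V: "C1_on_open V UNIV" and "a \<le> b"
    and ac: "absolutely_continuous_on_interval a b x"
    and flow: "AE t in lebesgue. t \<in> {a<..<b} \<longrightarrow>
           (x has_vector_derivative F t) (at t) \<and> gradient V (x t) \<bullet> F t \<le> - c"
  shows "V (x b) + c * (b - a) \<le> V (x a)"
proof -
  have "compact (x ` {a..b})"
    using compact_continuous_image[OF absolutely_continuous_imp_continuous_on[OF ac] compact_Icc] .
  then obtain R where R: "x ` {a..b} \<subseteq> cball 0 R"
    using compact_imp_bounded[of "x ` {a..b}"] unfolding bounded_iff by (auto simp: subset_iff)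
  obtain L where L: "\<And>y z. \<lbrakk>y \<in> cball 0 R; z \<in> cball 0 R\<rbrakk> \<Longrightarrow> \<bar>V y - V z\<bar> \<le> L * norm (y - z)"
    using C1_lipschitz_on_cball[OF V] by blast
  define M where "M = \<bar>L\<bar> + \<bar>c\<bar> + 1"
  define k where "k = (\<lambda>t. V (x t) + c * t)"
  have "absolutely_continuous_on_interval a b k"
  proof (rule absolutely_continuous_dominated[OF ac])
    fix u v assume uv: "a \<le> u" "u \<le> v" "v \<le> b"
    then have "\<bar>V (x v) - V (x u)\<bar> \<le> L * norm (x v - x u)"
      using R by (intro L) (auto simp: image_subset_iff)
    also have "\<dots> \<le> M * norm (x v - x u)"
      by (intro mult_right_mono) (auto simp: M_def)
    finally have 1: "\<bar>V (x v) - V (x u)\<bar> \<le> M * norm (x v - x u)" .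
    have "\<bar>c * v - c * u\<bar> = \<bar>c\<bar> * (v - u)"
      using uv by (simp add: abs_mult flip: right_diff_distrib)
    also have "\<dots> \<le> M * (v - u)"
      using uv by (intro mult_right_mono) (auto simp: M_def)
    finally show "norm (k v - k u) \<le> M * (norm (x v - x u) + (v - u))"
      using 1 by (simp add: k_def distrib_left)
  qed (simp add: M_def)
  moreover obtain N where "negligible N" and
    N: "{t. \<not> (t \<in> {a<..<b} \<longrightarrow>
           (x has_vector_derivative F t) (at t) \<and> gradient V (x t) \<bullet> F t \<le> - c)} \<subseteq> N"
    using flow unfolding eventually_ae_filter_negligible by blast
  have "negligible (N \<union> {a, b})"
    using \<open>negligible N\<close> by (intro negligible_Un) auto
  moreover have "\<exists>D\<le>0. (k has_real_derivative D) (at t within {a..b})"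
    if t: "t \<in> {a..b} - (N \<union> {a, b})" for t
  proof -
    have F: "(x has_vector_derivative F t) (at t)" "gradient V (x t) \<bullet> F t \<le> - c"
    proof -
      have "t \<notin> {t. \<not> (t \<in> {a<..<b} \<longrightarrow>
           (x has_vector_derivative F t) (at t) \<and> gradient V (x t) \<bullet> F t \<le> - c)}"
        using N t by blast
      then show "(x has_vector_derivative F t) (at t)" "gradient V (x t) \<bullet> F t \<le> - c"
        using t by simp_all
    qed
    have "(V has_derivative (\<lambda>h. h \<bullet> gradient V (x t))) (at (x t))"
      using V GDERIV_imp_gradient[of V "x t"] unfolding C1_on_open_def gderiv_def by auto
    then have "((\<lambda>t. V (x t)) has_derivative (\<lambda>s. (s *\<^sub>R F t) \<bullet> gradient V (x t))) (at t)"
      using has_derivative_compose F(1) unfolding has_vector_derivative_def by blast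
    then have "((\<lambda>t. V (x t)) has_real_derivative gradient V (x t) \<bullet> F t) (at t)"
      unfolding has_field_derivative_def
      by (rule has_derivative_eq_rhs) (auto simp: inner_commute mult.commute)
    then have "(k has_real_derivative gradient V (x t) \<bullet> F t + c) (at t)"
      unfolding k_def by (auto intro!: derivative_eq_intros)
    then show ?thesis
      using F(2) by (intro exI[of _ "gradient V (x t) \<bullet> F t + c"])
        (auto intro: has_field_derivative_at_within)
  qed
  ultimately have "k b \<le> k a"
    using absolutely_continuous_nonincreasing[OF \<open>a \<le> b\<close>] by blast
  then show ?thesis by (simp add: k_def right_diff_distrib)
qed

text \<open>Each unit of hybrid time, spent flowing or jumping, costs at least \<open>c\<close>. The rates are
  only required at points visited by the solution, so that \<open>c\<close> may depend on bounds already known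
  for it. Smoothness of \<open>V\<close> is only required if there is something to flow on, which admits
  the case of an empty flow set.\<close>

lemma decrease_along_solution:
  fixes V :: "'x::euclidean_space \<Rightarrow> real"
  assumes sol: "hybrid_solution S E \<phi>"
    and V: "auto_flow_set S \<noteq> {} \<Longrightarrow> C1_on_open V UNIV"
    and flow: "\<And>t j. \<lbrakk>(t, j) \<in> E; \<phi> t j \<in> auto_flow_set S\<rbrakk>
                 \<Longrightarrow> gradient V (\<phi> t j) \<bullet> auto_flow_map S (\<phi> t j) \<le> - c"
    and jump: "\<And>t j. \<lbrakk>(t, j) \<in> E; \<phi> t j \<in> auto_jump_set S\<rbrakk>
                 \<Longrightarrow> V (auto_jump_map S (\<phi> t j)) + c \<le> V (\<phi> t j)"
    and TJ: "(T, J) \<in> E"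
  shows "V (\<phi> T J) + c * (T + real J) \<le> V (\<phi> 0 0)"
proof -
  note sol' = sol[unfolded hybrid_solution_def]
  have dom: "hybrid_time_domain E"
    using sol' by (rule conjunct1)
  have ac: "absolutely_continuous_on_interval a b (\<lambda>t. \<phi> t j)"
    if "a \<le> b" "{a..b} \<subseteq> time_slice E j" for j a b
    using conjunct1[OF conjunct2[OF conjunct2[OF sol']]] that by blast
  have inC: "\<phi> t j \<in> auto_flow_set S" if "t \<in> interior (time_slice E j)" for j t
    using conjunct1[OF conjunct2[OF conjunct2[OF conjunct2[OF sol']]]] that by blast
  have ode: "AE t in lebesgue. t \<in> interior (time_slice E j) \<longrightarrow>
                ((\<lambda>s. \<phi> s j) has_vector_derivative auto_flow_map S (\<phi> t j)) (at t)" for j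
    using conjunct1[OF conjunct2[OF conjunct2[OF conjunct2[OF conjunct2[OF sol']]]]] ..
  have jmp: "\<phi> t j \<in> auto_jump_set S \<and> \<phi> t (Suc j) = auto_jump_map S (\<phi> t j)"
    if "(t, j) \<in> E" "(t, Suc j) \<in> E" for t j
    using conjunct2[OF conjunct2[OF conjunct2[OF conjunct2[OF conjunct2[OF sol']]]]] that by blast
  \<comment> \<open>A nondegenerate time interval forces the flow set to be nonempty, which makes \<open>V\<close> smooth.\<close>
  have on_slice: "V (\<phi> b j) + c * (b - a) \<le> V (\<phi> a j)" if "a \<le> b" "{a..b} \<subseteq> time_slice E j" for a b j
  proof (cases "a = b")
    case False
    have int: "{a<..<b} \<subseteq> interior (time_slice E j)"
      using interior_mono[OF that(2)] by simp
    have slice: "(t, j) \<in> E" if "t \<in> {a<..<b}" for t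
      using int that interior_subset by (fastforce simp: time_slice_def)
    have "(a + b) / 2 \<in> {a<..<b}" using False that by auto
    then have "auto_flow_set S \<noteq> {}" using int inC by blast
    moreover have "AE t in lebesgue. t \<in> {a<..<b} \<longrightarrow>
        ((\<lambda>s. \<phi> s j) has_vector_derivative auto_flow_map S (\<phi> t j)) (at t) \<and>
        gradient V (\<phi> t j) \<bullet> auto_flow_map S (\<phi> t j) \<le> - c"
      using ode[of j] by (rule AE_mp) (use int inC flow slice in \<open>auto intro!: AE_I2\<close>)
    ultimately show ?thesis
      using decrease_along_flow[OF V that(1) ac[OF that], where F = "\<lambda>t. auto_flow_map S (\<phi> t j)"] by blast
  qed simp
  obtain N \<tau> where \<tau>0: "\<tau> 0 = 0" and mono: "\<And>j. j < N \<Longrightarrow> \<tau> j \<le> \<tau> (Suc j)"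
    and E: "E \<inter> ({0..T} \<times> {0..J}) = (\<Union>j<N. {\<tau> j..\<tau> (Suc j)} \<times> {j})"
    using dom TJ unfolding hybrid_time_domain_def by (auto dest!: bspec) 
  have "T \<ge> 0" using dom TJ unfolding hybrid_time_domain_def by auto
  then have "(T, J) \<in> (\<Union>j<N. {\<tau> j..\<tau> (Suc j)} \<times> {j})"
    using TJ unfolding E[symmetric] by simp
  then have J: "J < N" "\<tau> J \<le> T" "T \<le> \<tau> (Suc J)" by auto
  have piece: "(t, j) \<in> E" if "j < N" "\<tau> j \<le> t" "t \<le> \<tau> (Suc j)" for t j
    using that E by (auto dest: equalityD2)
  \<comment> \<open>Follow the solution to the beginning \<open>\<tau> j\<close> of the flow on slice \<open>j\<close>.\<close>
  have "V (\<phi> (\<tau> j) j) + c * (\<tau> j + real j) \<le> V (\<phi> 0 0)" if "j \<le> J" for j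
    using that
  proof (induction j)
    case 0 then show ?case by (simp add: \<tau>0)
  next
    case (Suc j)
    then have j: "j < N" "Suc j < N" using J by auto
    let ?s = "\<tau> (Suc j)"
    have "V (\<phi> ?s j) + c * (?s - \<tau> j) \<le> V (\<phi> (\<tau> j) j)"
      using mono[OF j(1)] piece[OF j(1)] by (intro on_slice) (auto simp: time_slice_def)
    moreover have "(?s, j) \<in> E" "(?s, Suc j) \<in> E"
      using piece j mono by auto
    then have "V (\<phi> ?s (Suc j)) + c \<le> V (\<phi> ?s j)"
      using jmp[of ?s j] jump[of ?s j] by simp
    ultimately show ?case
      using Suc by (simp add: algebra_simps)
  qed
  from this[of J] have "V (\<phi> (\<tau> J) J) + c * (\<tau> J + real J) \<le> V (\<phi> 0 0)" by simp
  moreover have "V (\<phi> T J) + c * (T - \<tau> J) \<le> V (\<phi> (\<tau> J) J)"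
    using J piece[of J] by (intro on_slice) (auto simp: time_slice_def)
  ultimately show ?thesis by (simp add: algebra_simps)
qed

section \<open>Asymptotic stability\<close>

lemma neighbourhood_iff_infdist:
  fixes K :: "'x::euclidean_space set"
  assumes "compact K" "K \<noteq> {}" "0 \<le> e"
  shows "z \<in> {x + y |x y. x \<in> K \<and> y \<in> cball 0 e} \<longleftrightarrow> infdist z K \<le> e"
proof
  assume "z \<in> {x + y |x y. x \<in> K \<and> y \<in> cball 0 e}"
  then obtain x y where "z = x + y" "x \<in> K" "norm y \<le> e" by auto
  then show "infdist z K \<le> e"
    using infdist_le2[of x K z e] by (simp add: dist_norm)
next
  assume "infdist z K \<le> e"
  moreover obtain x where "x \<in> K" "infdist z K = dist z x"
    using infdist_attains_inf[OF compact_imp_closed[OF assms(1)] assms(2)] by blast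
  ultimately have "z = x + (z - x)" "x \<in> K" "z - x \<in> cball 0 e"
    by (simp_all add: dist_norm norm_minus_commute)
  then show "z \<in> {x + y |x y. x \<in> K \<and> y \<in> cball 0 e}"
    by blast
qed

text \<open>With nowhere to flow or jump, every solution stays at hybrid time \<open>(0, 0)\<close>: this is
  the decrease estimate for the zero function with \<open>c = 1\<close>.\<close>

lemma asymptotically_stable_trivial_system:
  assumes "auto_flow_set S = {}" "auto_jump_set S = {}"
  shows "asymptotically_stable S K"
proof -
  have dom: "t = 0 \<and> j = 0" if "hybrid_solution S E \<phi>" "(t, j) \<in> E" for E \<phi> t j
  proof -
    have "0 + 1 * (t + real j) \<le> 0"
      using decrease_along_solution[OF that(1), of "\<lambda>_. 0" 1 t j] assms that(2) by simp
    moreover have "t \<ge> 0"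
      using that unfolding hybrid_solution_def hybrid_time_domain_def by auto
    ultimately show ?thesis by simp
  qed
  show ?thesis
    unfolding asymptotically_stable_def
  proof (intro conjI allI impI)
    fix \<epsilon> :: real assume "\<epsilon> > 0"
    show "\<exists>\<delta>>0. \<forall>E \<phi>. maximal_solution S E \<phi> \<and> \<phi> 0 0 \<in> {x + y |x y. x \<in> K \<and> y \<in> cball 0 \<delta>} \<longrightarrow>
        (\<forall>(t, j) \<in> E. \<phi> t j \<in> {x + y |x y. x \<in> K \<and> y \<in> cball 0 \<epsilon>})"
    proof (intro exI[of _ \<epsilon>] conjI allI impI, goal_cases)
      case (2 E \<phi>)
      then have sol: "hybrid_solution S E \<phi>" by (simp add: maximal_solution_def)
      show ?case
      proof (rule ballI)
        fix z assume "z \<in> E"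
        then have "fst z = 0 \<and> snd z = 0" using dom[OF sol, of "fst z" "snd z"] by simp
        then show "case z of (t, j) \<Rightarrow> \<phi> t j \<in> {x + y |x y. x \<in> K \<and> y \<in> cball 0 \<epsilon>}"
          using 2 by (simp only: case_prod_beta)
      qed
    qed fact
  next
    fix E \<phi> assume "maximal_solution S E \<phi>"
    then have *: "\<And>t j. (t, j) \<in> E \<Longrightarrow> t = 0 \<and> j = 0"
      using dom unfolding maximal_solution_def by blast
    then have "{\<phi> t j |t j. (t, j) \<in> E} \<subseteq> {\<phi> 0 0}" by blast
    then show "bounded {\<phi> t j |t j. (t, j) \<in> E}"
      by (rule bounded_subset[rotated]) simp
    assume "complete_domain E"
    then obtain t j where "(t, j) \<in> E" "t + real j > 0"
      unfolding complete_domain_def by blast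
    with * show "\<exists>N. \<forall>(t, j) \<in> E. t + real j \<ge> N \<longrightarrow> infdist (\<phi> t j) K < \<epsilon>" for \<epsilon>
      by fastforce
  qed
qed

text \<open>Motion is possible only where \<open>V \<ge> r\<close>, and there the decrease rate \<open>d\<close> is positive. On the
  compact set of points with \<open>V\<close> between \<open>r\<close> and the initial value, \<open>d\<close> has a positive lower bound,
  so the nonnegative function \<open>V\<close> allows only a bounded amount of hybrid time. No solution is
  therefore complete, and attractivity is vacuous. Stability and boundedness follow from monotonicity
  of \<open>V\<close> along solutions together with compactness of its sublevel sets.\<close>

lemma asymptotically_stable_sublevel:
  fixes V :: "'x::euclidean_space \<Rightarrow> real"
  assumes V: "continuous_on UNIV V" "\<And>x. 0 \<le> V x" "\<And>s. compact {x. V x \<le> s}"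
    and C1: "auto_flow_set S \<noteq> {} \<Longrightarrow> C1_on_open V UNIV"
    and d: "continuous_on UNIV d" "\<And>x. r \<le> V x \<Longrightarrow> d x > 0"
    and flow: "\<And>x. x \<in> auto_flow_set S \<Longrightarrow> r \<le> V x \<and> gradient V x \<bullet> auto_flow_map S x \<le> - d x"
    and jump: "\<And>x. x \<in> auto_jump_set S \<Longrightarrow> r \<le> V x \<and> V (auto_jump_map S x) \<le> V x - d x"
  shows "asymptotically_stable S {x. V x \<le> r}"
proof -
  define K where "K = {x. V x \<le> r}"
  have K: "compact K" using V(3) by (simp add: K_def)
  have mono: "V (\<phi> t j) \<le> V (\<phi> 0 0)" if "hybrid_solution S E \<phi>" "(t, j) \<in> E" for E \<phi> t j
  proof -
    have "gradient V x \<bullet> auto_flow_map S x \<le> - 0" if "x \<in> auto_flow_set S" for x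
      using flow[OF that] d(2)[of x] by simp
    moreover have "V (auto_jump_map S x) + 0 \<le> V x" if "x \<in> auto_jump_set S" for x
      using jump[OF that] d(2)[of x] by simp
    ultimately show ?thesis
      using decrease_along_solution[OF that(1) C1 _ _ that(2), of 0] by simp
  qed
  have bounded_time: "\<exists>M. \<forall>(t, j) \<in> E. t + real j \<le> M" if sol: "hybrid_solution S E \<phi>" for E \<phi>
  proof -
    \<comment> \<open>All points from which the solution moves lie in \<open>B\<close>.\<close>
    define B where "B = {x. V x \<le> V (\<phi> 0 0)} \<inter> {x. r \<le> V x}"
    have "compact B"
      unfolding B_def by (intro compact_Int_closed V(3) closed_Collect_le continuous_intros V(1))
    have "\<exists>c>0. \<forall>x\<in>B. c \<le> d x"
    proof (cases "B = {}")
      case False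
      then obtain y where "y \<in> B" "\<forall>x\<in>B. d y \<le> d x"
        using continuous_attains_inf[OF \<open>compact B\<close> _ continuous_on_subset[OF d(1)]] by blast
      then show ?thesis using d(2)[of y] by (auto simp: B_def)
    qed (auto intro: exI[of _ 1])
    then obtain c where "c > 0" and c: "\<And>x. x \<in> B \<Longrightarrow> c \<le> d x" by blast
    have "V (\<phi> t j) + c * (t + real j) \<le> V (\<phi> 0 0)" if "(t, j) \<in> E" for t j
    proof (rule decrease_along_solution[OF sol C1 _ _ that])
      fix s i assume si: "(s, i) \<in> E" "\<phi> s i \<in> auto_flow_set S"
      then have "\<phi> s i \<in> B" using mono[OF sol si(1)] flow by (simp add: B_def)
      then show "gradient V (\<phi> s i) \<bullet> auto_flow_map S (\<phi> s i) \<le> - c"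
        using c flow[OF si(2)] by force
    next
      fix s i assume si: "(s, i) \<in> E" "\<phi> s i \<in> auto_jump_set S"
      then have "\<phi> s i \<in> B" using mono[OF sol si(1)] jump by (simp add: B_def)
      then show "V (auto_jump_map S (\<phi> s i)) + c \<le> V (\<phi> s i)"
        using c jump[OF si(2)] by force
    qed
    then have "t + real j \<le> V (\<phi> 0 0) / c" if "(t, j) \<in> E" for t j
      using that V(2)[of "\<phi> t j"] \<open>c > 0\<close> by (fastforce simp: field_simps)
    then show ?thesis by blast
  qed
  show ?thesis
    unfolding asymptotically_stable_def K_def[symmetric]
  proof (intro conjI allI impI)
    fix \<epsilon> :: real assume "\<epsilon> > 0"
    show "\<exists>\<delta>>0. \<forall>E \<phi>. maximal_solution S E \<phi> \<and> \<phi> 0 0 \<in> {x + y |x y. x \<in> K \<and> y \<in> cball 0 \<delta>} \<longrightarrow>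
        (\<forall>(t, j) \<in> E. \<phi> t j \<in> {x + y |x y. x \<in> K \<and> y \<in> cball 0 \<epsilon>})"
    proof (cases "K = {}")
      case True then show ?thesis by (auto intro: exI[of _ 1])
    next
      case False
      \<comment> \<open>Some sublevel set \<open>{x. V x < q}\<close> with \<open>q > r\<close> lies in the \<open>\<epsilon>\<close>-neighbourhood of \<open>K\<close>: on the
        compact set \<open>B\<close> the minimum of \<open>V\<close> exceeds \<open>r\<close>.\<close>
      define B where "B = {x. V x \<le> r + 1} \<inter> {x. \<epsilon> \<le> infdist x K}"
      have "compact B"
        unfolding B_def by (intro compact_Int_closed V(3) closed_Collect_le continuous_intros)
      have far: "r < V x" if "x \<in> B" for x
      proof (rule ccontr)
        assume "\<not> r < V x"
        then have "infdist x K = 0" by (simp add: K_def)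
        with that \<open>\<epsilon> > 0\<close> show False by (simp add: B_def)
      qed
      have "\<exists>m>r. \<forall>x\<in>B. m \<le> V x"
      proof (cases "B = {}")
        case False
        then obtain y where "y \<in> B" "\<forall>x\<in>B. V y \<le> V x"
          using continuous_attains_inf[OF \<open>compact B\<close> _ continuous_on_subset[OF V(1)]] by blast
        then show ?thesis using far by blast
      qed (auto intro: exI[of _ "r + 1"])
      then obtain m where "m > r" and m: "\<And>x. x \<in> B \<Longrightarrow> m \<le> V x" by blast
      define q where "q = min m (r + 1)"
      have near: "infdist x K \<le> \<epsilon>" if "V x < q" for x
        using that m[of x] by (fastforce simp: q_def B_def)
      have "open {x. V x < q}"
        by (rule open_Collect_less[OF V(1) continuous_on_const])
      moreover have "K \<subseteq> {x. V x < q}"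
        using \<open>m > r\<close> by (auto simp: q_def K_def)
      ultimately obtain e where "e > 0" and e: "(\<Union>x\<in>K. ball x e) \<subseteq> {x. V x < q}"
        using compact_subset_open_imp_ball_epsilon_subset[OF K] by blast
      show ?thesis
      proof (intro exI[of _ "e / 2"] conjI allI impI)
        fix E \<phi> assume *: "maximal_solution S E \<phi> \<and> \<phi> 0 0 \<in> {x + y |x y. x \<in> K \<and> y \<in> cball 0 (e / 2)}"
        then obtain x y where "\<phi> 0 0 = x + y" "x \<in> K" "norm y \<le> e / 2" by auto
        then have "V (\<phi> 0 0) < q"
          using e \<open>e > 0\<close> by (force simp: dist_norm)
        moreover have "hybrid_solution S E \<phi>"
          using * by (simp add: maximal_solution_def)
        ultimately have "V (\<phi> t j) < q" if "(t, j) \<in> E" for t j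
          using mono that by (meson order_le_less_trans)
        then show "\<forall>(t, j) \<in> E. \<phi> t j \<in> {x + y |x y. x \<in> K \<and> y \<in> cball 0 \<epsilon>}"
          unfolding neighbourhood_iff_infdist[OF K False less_imp_le[OF \<open>\<epsilon> > 0\<close>]]
          using near by auto
      qed (use \<open>e > 0\<close> in simp)
    qed
  next
    fix E \<phi> assume "maximal_solution S E \<phi>"
    then have sol: "hybrid_solution S E \<phi>" by (simp add: maximal_solution_def)
    have "{\<phi> t j |t j. (t, j) \<in> E} \<subseteq> {x. V x \<le> V (\<phi> 0 0)}"
      using mono[OF sol] by blast
    then show "bounded {\<phi> t j |t j. (t, j) \<in> E}"
      using compact_imp_bounded[OF V(3)] by (rule bounded_subset[rotated])
    assume "complete_domain E"
    moreover obtain M where "\<And>t j. (t, j) \<in> E \<Longrightarrow> t + real j \<le> M"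
      using bounded_time[OF sol] by blast
    ultimately have False
      unfolding complete_domain_def by (metis (mono_tags, lifting) case_prodE2 not_less prod.collapse case_prod_beta)
    then show "\<exists>N. \<forall>(t, j) \<in> E. t + real j \<ge> N \<longrightarrow> infdist (\<phi> t j) K < \<epsilon>" for \<epsilon> ..
  qed
qed

section \<open>Minimal-norm selections\<close>

lemma unique_min_norm_element:
  fixes T :: "'u::euclidean_space set"
  assumes "closed T" "convex T" "T \<noteq> {}"
  shows "\<exists>!u. is_arg_min norm (\<lambda>u. u \<in> T) u"
proof -
  have eq: "is_arg_min norm (\<lambda>u. u \<in> T) u \<longleftrightarrow> u \<in> T \<and> (\<forall>v\<in>T. dist 0 u \<le> dist 0 v)" for u
    by (auto simp: is_arg_min_def not_less)
  show ?thesis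
    unfolding eq using distance_attains_inf[OF assms(1,3), of 0] any_closest_point_unique[OF assms(2,1)]
    by metis
qed

lemma tendsto_if_unique_limit_point:
  fixes u :: "nat \<Rightarrow> 'u::heine_borel"
  assumes bdd: "bounded (range u)"
    and lim: "\<And>s w. \<lbrakk>strict_mono s; (u \<circ> s) \<longlonglongrightarrow> w\<rbrakk> \<Longrightarrow> w = l"
  shows "u \<longlonglongrightarrow> l"
proof (rule ccontr)
  assume "\<not> u \<longlonglongrightarrow> l"
  then obtain e where "e > 0" and e: "\<forall>N. \<exists>n\<ge>N. e \<le> dist (u n) l"
    unfolding lim_sequentially by (auto simp: not_less)
  then have "infinite {n. e \<le> dist (u n) l}"
    by (simp add: infinite_nat_iff_unbounded_le)
  then obtain s :: "nat \<Rightarrow> nat" where s: "strict_mono s" "\<And>n. e \<le> dist (u (s n)) l"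
    using infinite_enumerate[of "{n. e \<le> dist (u n) l}"] by auto
  have "bounded (range (u \<circ> s))"
    using bdd by (rule bounded_subset) auto
  then obtain w s' where s': "strict_mono s'" "((u \<circ> s) \<circ> s') \<longlonglongrightarrow> w"
    using bounded_imp_convergent_subsequence by blast
  then have "w = l"
    using lim[of "s \<circ> s'" w] s(1) by (simp add: o_assoc strict_mono_o)
  then have "(\<lambda>n. dist (u (s (s' n))) l) \<longlonglongrightarrow> 0"
    using tendsto_dist[OF s'(2) tendsto_const[of l]] by (simp add: o_def)
  then have "e \<le> 0"
    by (rule tendsto_lowerbound) (auto simp: s(2))
  with \<open>e > 0\<close> show False by simp
qed

definition feasible_inputs where
  "feasible_inputs \<Psi> h x = {u \<in> \<Psi> x. h (x, u) \<le> (0::real)}"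

lemma feasible_inputs_closed_convex:
  fixes \<Psi> :: "'x::euclidean_space \<Rightarrow> 'u::euclidean_space set"
  assumes graph: "has_closed_graph \<Psi>" and h: "continuous_on UNIV h"
    and conv: "convex_on (\<Psi> x) (\<lambda>u. h (x, u))"
  shows "closed (feasible_inputs \<Psi> h x)" "convex (feasible_inputs \<Psi> h x)"
proof -
  have "feasible_inputs \<Psi> h x = Pair x -` ({(x, u). u \<in> \<Psi> x} \<inter> {z. h z \<le> 0})"
    by (auto simp: feasible_inputs_def)
  moreover have "closed ({(x, u). u \<in> \<Psi> x} \<inter> {z. h z \<le> 0})"
    using graph h unfolding has_closed_graph_def
    by (intro closed_Int closed_Collect_le continuous_intros)
  moreover have "continuous_on UNIV (Pair x :: 'u \<Rightarrow> _)"
    by (intro continuous_intros)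
  ultimately show "closed (feasible_inputs \<Psi> h x)"
    by (simp only: closed_vimage)
  show "convex (feasible_inputs \<Psi> h x)"
    unfolding feasible_inputs_def
  proof (rule convexI)
    fix u v and s t :: real
    assume uv: "u \<in> {u \<in> \<Psi> x. h (x, u) \<le> 0}" "v \<in> {u \<in> \<Psi> x. h (x, u) \<le> 0}"
      and st: "0 \<le> s" "0 \<le> t" "s + t = 1"
    have "h (x, s *\<^sub>R u + t *\<^sub>R v) \<le> s * h (x, u) + t * h (x, v)"
      using conv uv st unfolding convex_on_def by blast
    also have "\<dots> \<le> 0"
      using uv st by (simp add: add_nonpos_nonpos mult_nonneg_nonpos)
    finally show "s *\<^sub>R u + t *\<^sub>R v \<in> {u \<in> \<Psi> x. h (x, u) \<le> 0}"
      using convexD[OF convex_on_imp_convex[OF conv], of u v s t] uv st by simp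
  qed
qed

lemma min_norm_selection_exists_unique:
  fixes \<Psi> :: "'x::euclidean_space \<Rightarrow> 'u::euclidean_space set"
  assumes "has_closed_graph \<Psi>" "continuous_on UNIV h"
    and "convex_on (\<Psi> x) (\<lambda>u. h (x, u))" and "\<exists>u\<in>\<Psi> x. h (x, u) < 0"
  shows "\<exists>!u. is_arg_min norm (\<lambda>u. u \<in> feasible_inputs \<Psi> h x) u"
proof (rule unique_min_norm_element)
  show "feasible_inputs \<Psi> h x \<noteq> {}"
    using assms(4) by (force simp: feasible_inputs_def)
qed (use feasible_inputs_closed_convex[OF assms(1-3)] in auto)

text \<open>Let \<open>x\<^sub>n\<close> tend to \<open>x\<close>. Moving slightly from \<open>\<rho> x\<close> towards a strictly feasible input gives, by
  convexity, a strictly feasible input \<open>w\<close> of almost the same norm. Lower semicontinuity approximates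
  \<open>w\<close> by inputs \<open>z\<^sub>n \<in> \<Psi> x\<^sub>n\<close>, which are eventually feasible since the constraint is strict at \<open>w\<close>; thus
  the norms of \<open>\<rho> x\<^sub>n\<close> are asymptotically at most that of \<open>\<rho> x\<close>. Limit points of \<open>\<rho> x\<^sub>n\<close> are feasible
  at \<open>x\<close> by the closed graph, so they are minimal there and equal to \<open>\<rho> x\<close> by uniqueness.\<close>

lemma min_norm_selection_continuous:
  fixes \<Psi> :: "'x::euclidean_space \<Rightarrow> 'u::euclidean_space set"
  assumes graph: "has_closed_graph \<Psi>" and lsc: "lower_semicontinuous_map \<Psi>"
    and h: "continuous_on UNIV h"
    and conv: "\<And>x. x \<in> X \<Longrightarrow> convex_on (\<Psi> x) (\<lambda>u. h (x, u))"
    and slater: "\<And>x. x \<in> X \<Longrightarrow> \<exists>u\<in>\<Psi> x. h (x, u) < 0"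
    and sel: "\<And>x. x \<in> X \<Longrightarrow> is_arg_min norm (\<lambda>u. u \<in> feasible_inputs \<Psi> h x) (\<rho> x)"
  shows "continuous_on X \<rho>"
  unfolding continuous_on_sequentially
proof (intro allI ballI impI, elim conjE)
  fix xs :: "nat \<Rightarrow> 'x" and x
  assume x: "x \<in> X" and xsX: "\<forall>n. xs n \<in> X" and xs: "xs \<longlonglongrightarrow> x"
  have sel': "\<rho> y \<in> feasible_inputs \<Psi> h y" "\<And>u. u \<in> feasible_inputs \<Psi> h y \<Longrightarrow> norm (\<rho> y) \<le> norm u"
    if "y \<in> X" for y
    using sel[OF that] by (auto simp: is_arg_min_def not_less)
  have h_lim: "(\<lambda>n. h (ys n, us n)) \<longlonglongrightarrow> h (y, u)" if "ys \<longlonglongrightarrow> y" "us \<longlonglongrightarrow> u" for ys us y u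
    using continuous_on_tendsto_compose[OF h tendsto_Pair[OF that]] by simp
  obtain u' where u': "u' \<in> \<Psi> x" "h (x, u') < 0" using slater[OF x] by blast
  have below: "\<forall>\<^sub>F n in sequentially. norm (\<rho> (xs n)) < norm (\<rho> x) + e" if "e > 0" for e
  proof -
    define w where "w = (\<lambda>s::real. (1 - s) *\<^sub>R \<rho> x + s *\<^sub>R u')"
    have "((\<lambda>s. norm (w s)) \<longlongrightarrow> norm (w 0)) (at_right 0)"
      unfolding w_def by (intro tendsto_eq_intros) auto
    then have "\<forall>\<^sub>F s in at_right 0. norm (w s) < norm (\<rho> x) + e"
      using \<open>e > 0\<close> by (intro order_tendstoD(2)) (auto simp: w_def)
    moreover have "\<forall>\<^sub>F s in at_right (0::real). 0 < s \<and> s < 1"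
      by (auto simp: eventually_at_right_field intro: exI[of _ 1])
    ultimately have "\<forall>\<^sub>F s in at_right (0::real). norm (w s) < norm (\<rho> x) + e \<and> 0 < s \<and> s < 1"
      by eventually_elim auto
    then obtain s where s: "norm (w s) < norm (\<rho> x) + e" "0 < s" "s < 1"
      using eventually_happens'[OF trivial_limit_at_right_real] by blast
    have \<rho>x: "\<rho> x \<in> \<Psi> x" "h (x, \<rho> x) \<le> 0"
      using sel'(1)[OF x] by (auto simp: feasible_inputs_def)
    have "h (x, w s) \<le> (1 - s) * h (x, \<rho> x) + s * h (x, u')"
      unfolding w_def using \<rho>x u' s by (intro convex_onD[OF conv[OF x]]) auto
    also have "\<dots> < 0"
      using \<rho>x u' s by (intro add_nonpos_neg mult_nonneg_nonpos mult_pos_neg) auto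
    finally have hw: "h (x, w s) < 0" .
    have "w s \<in> \<Psi> x"
      unfolding w_def using conv[OF x] \<rho>x u' s by (intro convexD[OF convex_on_imp_convex[OF conv[OF x]]]) auto
    then obtain zs where zs: "zs \<longlonglongrightarrow> w s" "\<And>n. zs n \<in> \<Psi> (xs n)"
      using lsc xs unfolding lower_semicontinuous_map_def inner_limit_def by blast
    have "\<forall>\<^sub>F n in sequentially. h (xs n, zs n) < 0"
      using order_tendstoD(2)[OF h_lim[OF xs zs(1)] hw] .
    moreover have "\<forall>\<^sub>F n in sequentially. norm (zs n) < norm (\<rho> x) + e"
      using order_tendstoD(2)[OF tendsto_norm[OF zs(1)] s(1)] .
    ultimately show ?thesis
    proof eventually_elim
      case (elim n)
      then have "zs n \<in> feasible_inputs \<Psi> h (xs n)"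
        using zs(2) by (simp add: feasible_inputs_def)
      then show ?case
        using sel'(2) xsX elim(2) by (meson order_le_less_trans)
    qed
  qed
  have "(\<lambda>n. \<rho> (xs n)) \<longlonglongrightarrow> \<rho> x"
  proof (rule tendsto_if_unique_limit_point)
    have "Bseq (\<lambda>n. \<rho> (xs n))"
      using eventually_mono[OF below[of 1]]
      by (intro BfunI[where K = "norm (\<rho> x) + 1"]) (auto intro: less_imp_le)
    then show "bounded (range (\<lambda>n. \<rho> (xs n)))"
      by (simp add: Bseq_eq_bounded)
  next
    fix s :: "nat \<Rightarrow> nat" and v assume s: "strict_mono s" "((\<lambda>n. \<rho> (xs n)) \<circ> s) \<longlonglongrightarrow> v"
    have xs_s: "(\<lambda>n. xs (s n)) \<longlonglongrightarrow> x"
      using LIMSEQ_subseq_LIMSEQ[OF xs s(1)] by (simp add: o_def)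
    have \<rho>_s: "(\<lambda>n. \<rho> (xs (s n))) \<longlonglongrightarrow> v" using s(2) by (simp add: o_def)
    have feas: "\<rho> (xs (s n)) \<in> \<Psi> (xs (s n))" "h (xs (s n), \<rho> (xs (s n))) \<le> 0" for n
      using sel'(1) xsX by (auto simp: feasible_inputs_def)
    have "(x, v) \<in> {(x, u). u \<in> \<Psi> x}"
    proof (rule closed_sequentially)
      show "closed {(x, u). u \<in> \<Psi> x}" using graph by (simp add: has_closed_graph_def)
      show "(\<lambda>n. (xs (s n), \<rho> (xs (s n)))) \<longlonglongrightarrow> (x, v)" by (rule tendsto_Pair[OF xs_s \<rho>_s])
    qed (simp add: feas)
    moreover have "h (x, v) \<le> 0"
      using LIMSEQ_le_const2[OF h_lim[OF xs_s \<rho>_s]] feas(2) by blast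
    ultimately have v: "v \<in> feasible_inputs \<Psi> h x" by (simp add: feasible_inputs_def)
    have "norm v \<le> norm (\<rho> x)"
    proof (rule field_le_epsilon)
      fix e :: real assume "e > 0"
      have "\<forall>\<^sub>F n in sequentially. norm (\<rho> (xs (s n))) \<le> norm (\<rho> x) + e"
        using eventually_subseq[OF s(1) below[OF \<open>e > 0\<close>]] by (rule eventually_mono) simp
      then show "norm v \<le> norm (\<rho> x) + e"
        using tendsto_upperbound[OF tendsto_norm[OF \<rho>_s]] by simp
    qed
    then have "is_arg_min norm (\<lambda>u. u \<in> feasible_inputs \<Psi> h x) v"
      using v sel'(2)[OF x] by (force simp: is_arg_min_def)
    then show "v = \<rho> x"
      using min_norm_selection_exists_unique[OF graph h conv[OF x] slater[OF x]] sel[OF x] by blast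
  qed
  then show "(\<rho> \<circ> xs) \<longlonglongrightarrow> \<rho> x" by (simp add: o_def)
qed

section \<open>Control Lyapunov functions for lower semicontinuous data\<close>

text \<open>The sequence \<open>y, x, x, \<dots>\<close> converges to \<open>x\<close>, and the inner limit asks for a selection at every
  index, including the first one.\<close>

lemma lower_semicontinuous_map_nonempty:
  fixes S :: "'x::topological_space \<Rightarrow> 'u::topological_space set"
  assumes "lower_semicontinuous_map S" and "S x \<noteq> {}"
  shows "S y \<noteq> {}"
proof -
  define xs where "xs = (\<lambda>i::nat. if i = 0 then y else x)"
  have "xs \<longlonglongrightarrow> x"
    by (rule tendsto_eventually) (auto simp: xs_def eventually_sequentially intro: exI[of _ 1])
  moreover obtain z where "z \<in> inner_limit S x"
    using assms unfolding lower_semicontinuous_map_def by blast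
  ultimately obtain zs where "\<And>i. zs i \<in> S (xs i)"
    unfolding inner_limit_def by blast
  from this[of 0] show ?thesis by (auto simp: xs_def)
qed

text \<open>Either no state or every state admits an input. This is what makes bounds that are assumed only on the
  projections of the flow and jump sets hold on the whole space.\<close>

lemma state_proj_UNIV:
  fixes S :: "('x::euclidean_space \<times> 'u::euclidean_space) set"
  assumes "closedin (top_of_set (UNIV \<times> U)) S" "lower_semicontinuous_map (input_fiber S)" "S \<noteq> {}"
  shows "state_proj U S = UNIV"
proof -
  obtain x u where "(x, u) \<in> S" using assms(3) by auto
  then have "input_fiber S x \<noteq> {}" by (auto simp: input_fiber_def)
  then have "input_fiber S y \<noteq> {}" for y
    using lower_semicontinuous_map_nonempty[OF assms(2)] by blast
  moreover have "S \<subseteq> UNIV \<times> U" using closedin_imp_subset[OF assms(1)] .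
  ultimately show ?thesis by (fastforce simp: state_proj_def input_fiber_def)
qed

lemma ereal_convex_on_imp_convex_on:
  assumes conv: "ereal_convex_on S F" and F: "\<And>u. u \<in> S \<Longrightarrow> F u = ereal (h u)"
  shows "convex_on S h"
proof -
  have "convex S" using conv by (simp add: ereal_convex_on_def)
  then show ?thesis
  proof (rule convex_onI[rotated])
    fix t :: real and x y assume t: "0 < t" "t < 1" and xy: "x \<in> S" "y \<in> S"
    have "F ((1 - t) *\<^sub>R x + t *\<^sub>R y) \<le> ereal (1 - t) * F x + ereal t * F y"
      using conv xy t unfolding ereal_convex_on_def by simp
    moreover have "(1 - t) *\<^sub>R x + t *\<^sub>R y \<in> S"
      using convexD[OF \<open>convex S\<close> xy, of "1 - t" t] t by simp
    ultimately show "h ((1 - t) *\<^sub>R x + t *\<^sub>R y) \<le> (1 - t) * h x + t * h y"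
      using F xy by simp
  qed
qed

lemma class_K_infinity_nonneg:
  assumes "class_K_infinity \<alpha>" "0 \<le> s"
  shows "0 \<le> \<alpha> s"
  using assms strict_mono_onD[of "{0..}" \<alpha> 0 s] unfolding class_K_infinity_def
  by (cases "s = 0") auto

lemma compact_sublevel_of_proper:
  fixes V :: "'x::euclidean_space \<Rightarrow> real"
  assumes "compact A" "A \<noteq> {}" "continuous_on UNIV V" "class_K_infinity \<alpha>"
    and lower: "\<And>x. \<alpha> (infdist x A) \<le> V x"
  shows "compact {x. V x \<le> s}"
proof -
  obtain t where t: "0 \<le> t" "s < \<alpha> t"
    using assms(4) unfolding class_K_infinity_def by blast
  have "infdist x A \<le> t + 1" if "V x \<le> s" for x
  proof (rule ccontr)
    assume "\<not> infdist x A \<le> t + 1"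
    then have "\<alpha> t < \<alpha> (infdist x A)"
      using assms(4) t unfolding class_K_infinity_def by (auto intro: strict_mono_onD)
    with lower[of x] that t show False by linarith
  qed
  then have "{x. V x \<le> s} = {x. infdist x A \<le> t + 1} \<inter> {x. V x \<le> s}"
    by auto
  moreover have "compact {x. infdist x A \<le> t + 1}"
    using assms(1,2) t by (intro compact_infdist_le) auto
  moreover have "closed {x. V x \<le> s}"
    by (rule closed_Collect_le[OF assms(3) continuous_on_const])
  ultimately show ?thesis
    using compact_Int_closed by metis
qed

lemma continuous_on_compose_fst:
  "continuous_on UNIV k \<Longrightarrow> continuous_on UNIV (\<lambda>z. k (fst z))"
  by (erule continuous_on_compose2) (auto intro: continuous_intros)

theorem proposition3p2:
  fixes A :: "(real ^ 'n) set"
    and Uc :: "(real ^ 'mc) set" and Ud :: "(real ^ 'md) set"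
    and H :: "(real ^ 'n, real ^ 'mc, real ^ 'md) hybrid_system"
    and V :: "real ^ 'n \<Rightarrow> real" and \<alpha>1 \<alpha>2 \<alpha>3 :: "real \<Rightarrow> real"
  assumes "compact A" and "A \<noteq> {}"
    and "hybrid_basic_conditions Uc Ud H"
    and "control_lyapunov_function A Uc Ud H V \<alpha>1 \<alpha>2 \<alpha>3"
    and M1c: "lower_semicontinuous_map (input_fiber (flow_set H))"
             "\<forall>x. convex (input_fiber (flow_set H) x)"
    and M1d: "lower_semicontinuous_map (input_fiber (jump_set H))"
             "\<forall>x. convex (input_fiber (jump_set H) x)"
    and M2c: "\<forall>r>0. \<forall>x \<in> state_proj Uc (flow_set H) \<inter> superlevel V r.
                ereal_convex_on (input_fiber (flow_set H) x) (\<lambda>u. Gamma_c A H V \<alpha>3 x u r)"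
    and M2d: "\<forall>r>0. \<forall>x \<in> state_proj Ud (jump_set H) \<inter> superlevel V r.
                ereal_convex_on (input_fiber (jump_set H) x) (\<lambda>u. Gamma_d A H V \<alpha>3 x u r)"
  shows "\<forall>r>0.
    (flow_set H \<noteq> {} \<or> jump_set H \<noteq> {} \<longrightarrow> compact {x. V x \<le> r}) \<and>
    (\<forall>\<rho>c \<rho>d. min_norm_pair A Uc Ud H V \<alpha>3 r \<rho>c \<rho>d \<longrightarrow>
       asymptotically_stable
         (closed_loop (restrict_system V r H)
            (R_c Uc H V \<inter> superlevel V r) \<rho>c (R_d Ud H V \<inter> superlevel V r) \<rho>d)
         {x. V x \<le> r}) \<and>
    (has_closed_graph (input_fiber (flow_set H)) \<and> has_closed_graph (input_fiber (jump_set H)) \<and>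
     strictly_feasible A Uc Ud H V \<alpha>3 r \<longrightarrow>
       (\<forall>x \<in> R_c Uc H V \<inter> superlevel V r. \<exists>!u. is_arg_min norm (\<lambda>u. u \<in> T_c A Uc H V \<alpha>3 x) u) \<and>
       (\<forall>x \<in> R_d Ud H V \<inter> superlevel V r. \<exists>!u. is_arg_min norm (\<lambda>u. u \<in> T_d A Ud H V \<alpha>3 x) u) \<and>
       (\<forall>\<rho>c \<rho>d. min_norm_pair A Uc Ud H V \<alpha>3 r \<rho>c \<rho>d \<longrightarrow>
          continuous_on (R_c Uc H V \<inter> superlevel V r) \<rho>c \<and>
          continuous_on (R_d Ud H V \<inter> superlevel V r) \<rho>d))"
proof (intro allI impI)
  fix r :: real assume "r > 0"
  let ?C = "flow_set H" and ?D = "jump_set H"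
  let ?Xc = "R_c Uc H V \<inter> superlevel V r" and ?Xd = "R_d Ud H V \<inter> superlevel V r"
  \<comment> \<open>The finite values of \<open>Gamma_c\<close> and \<open>Gamma_d\<close>, written as constraint functions on state and input.\<close>
  define a3 where "a3 = (\<lambda>x. \<alpha>3 (infdist x A))"
  define hc where "hc = (\<lambda>(x, u). gradient V x \<bullet> flow_map H (x, u) + a3 x)"
  define hj where "hj = (\<lambda>(x, u). V (jump_map H (x, u)) - V x + a3 x)"
  have closed_C: "closedin (top_of_set (UNIV \<times> Uc)) ?C"
    and closed_D: "closedin (top_of_set (UNIV \<times> Ud)) ?D"
    and cont_f: "continuous_on UNIV (flow_map H)" and cont_g: "continuous_on UNIV (jump_map H)"
    using assms(3) unfolding hybrid_basic_conditions_def by - (elim conjE, assumption)+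
  have cont_V: "continuous_on UNIV V"
    and ex_W: "\<exists>W. closure (state_proj Uc ?C) \<subseteq> W \<and> C1_on_open V W"
    and K1: "class_K_infinity \<alpha>1" and K2: "class_K_infinity \<alpha>2" and pd: "positive_definite_fun \<alpha>3"
    and bounds: "\<forall>x \<in> state_proj Uc ?C \<union> state_proj Ud ?D \<union> jump_map H ` ?D.
        \<alpha>1 (infdist x A) \<le> V x \<and> V x \<le> \<alpha>2 (infdist x A)"
    using assms(4) unfolding control_lyapunov_function_def by - (elim conjE, assumption)+

  have cont_a3: "continuous_on UNIV a3"
  proof -
    have "continuous_on {0..} \<alpha>3" using pd by (simp add: positive_definite_fun_def)
    moreover have "continuous_on UNIV (\<lambda>x. infdist x A)" by (intro continuous_intros)
    moreover have "range (\<lambda>x. infdist x A) \<subseteq> {0..}" using infdist_nonneg by auto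
    ultimately show ?thesis unfolding a3_def by (rule continuous_on_compose2)
  qed
  have C1: "C1_on_open V UNIV" if "?C \<noteq> {}"
    using ex_W state_proj_UNIV[OF closed_C M1c(1) that] by (auto simp: top.extremum_unique)
  have everywhere: "\<alpha>1 (infdist x A) \<le> V x \<and> V x \<le> \<alpha>2 (infdist x A)" if "?C \<noteq> {} \<or> ?D \<noteq> {}" for x
    using bounds state_proj_UNIV[OF closed_C M1c(1)] state_proj_UNIV[OF closed_D M1d(1)] that by blast
  have compact: "compact {x. V x \<le> s}" if "?C \<noteq> {} \<or> ?D \<noteq> {}" for s
    using everywhere[OF that] by (intro compact_sublevel_of_proper[OF assms(1,2) cont_V K1]) blast
  have a3_pos: "a3 x > 0" if "?C \<noteq> {} \<or> ?D \<noteq> {}" "r \<le> V x" for x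
  proof -
    have "infdist x A \<noteq> 0"
      using everywhere[OF that(1), of x] that(2) \<open>r > 0\<close> K2 by (auto simp: class_K_infinity_def)
    then show ?thesis
      using pd infdist_nonneg[of x A] by (simp add: a3_def positive_definite_fun_def)
  qed

  have C_sub: "?C \<subseteq> UNIV \<times> Uc" and D_sub: "?D \<subseteq> UNIV \<times> Ud"
    using closedin_imp_subset[OF closed_C] closedin_imp_subset[OF closed_D] by auto
  have Tc: "T_c A Uc H V \<alpha>3 x = feasible_inputs (input_fiber ?C) hc x" for x
    using C_sub by (auto simp: T_c_def Upsilon_c_def Gamma_c_def superlevel_def
        feasible_inputs_def input_fiber_def hc_def a3_def)
  have Td: "T_d A Ud H V \<alpha>3 x = feasible_inputs (input_fiber ?D) hj x" for x
    using D_sub by (auto simp: T_d_def Upsilon_d_def Gamma_d_def superlevel_def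
        feasible_inputs_def input_fiber_def hj_def a3_def)

  have stable: "asymptotically_stable
         (closed_loop (restrict_system V r H) ?Xc \<rho>c ?Xd \<rho>d) {x. V x \<le> r}"
    if pair: "min_norm_pair A Uc Ud H V \<alpha>3 r \<rho>c \<rho>d" for \<rho>c \<rho>d
  proof -
    let ?S = "closed_loop (restrict_system V r H) ?Xc \<rho>c ?Xd \<rho>d"
    have fs: "auto_flow_set ?S \<subseteq> {x\<in>?Xc. (x, \<rho>c x) \<in> ?C}"
      and js: "auto_jump_set ?S \<subseteq> {x\<in>?Xd. (x, \<rho>d x) \<in> ?D}"
      by (auto simp: closed_loop_def restrict_system_def)
    have fm: "auto_flow_map ?S x = flow_map H (x, \<rho>c x)"
      and jm: "auto_jump_map ?S x = jump_map H (x, \<rho>d x)" for x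
      by (auto simp: closed_loop_def restrict_system_def)
    show ?thesis
    proof (cases "?C \<noteq> {} \<or> ?D \<noteq> {}")
      case False
      then show ?thesis
        using fs js by (intro asymptotically_stable_trivial_system) auto
    next
      case True
      show ?thesis
      proof (rule asymptotically_stable_sublevel[where d = a3])
        show "0 \<le> V x" for x
          using everywhere[OF True, of x] class_K_infinity_nonneg[OF K1 infdist_nonneg[of x A]]
          by linarith
        show "C1_on_open V UNIV" if "auto_flow_set ?S \<noteq> {}"
          using C1 fs that by blast
        show "r \<le> V x \<and> gradient V x \<bullet> auto_flow_map ?S x \<le> - a3 x" if "x \<in> auto_flow_set ?S" for x
        proof -
          have x: "x \<in> ?Xc" using fs that by blast
          then have "\<rho>c x \<in> T_c A Uc H V \<alpha>3 x"
            using pair unfolding min_norm_pair_def is_arg_min_def by blast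
          then show ?thesis
            using x unfolding Tc fm by (simp add: feasible_inputs_def hc_def superlevel_def)
        qed
        show "r \<le> V x \<and> V (auto_jump_map ?S x) \<le> V x - a3 x" if "x \<in> auto_jump_set ?S" for x
        proof -
          have x: "x \<in> ?Xd" using js that by blast
          then have "\<rho>d x \<in> T_d A Ud H V \<alpha>3 x"
            using pair unfolding min_norm_pair_def is_arg_min_def by blast
          then show ?thesis
            using x unfolding Td jm by (simp add: feasible_inputs_def hj_def superlevel_def)
        qed
      qed (use cont_V compact[OF True] cont_a3 a3_pos[OF True] in auto)
    qed
  qed

  have cont_hc: "continuous_on UNIV hc" if "?C \<noteq> {}"
  proof -
    have "continuous_on UNIV (gradient V)" using C1[OF that] by (simp add: C1_on_open_def)
    then have "continuous_on UNIV (\<lambda>z. gradient V (fst z) \<bullet> flow_map H z + a3 (fst z))"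
      by (intro continuous_on_add continuous_on_inner cont_f continuous_on_compose_fst cont_a3)
    then show ?thesis by (simp add: hc_def case_prod_unfold)
  qed
  have cont_hd: "continuous_on UNIV hj"
  proof -
    have "continuous_on UNIV (\<lambda>z. V (jump_map H z) - V (fst z) + a3 (fst z))"
      by (intro continuous_on_add continuous_on_diff continuous_on_compose2[OF cont_V cont_g]
          continuous_on_compose_fst cont_V cont_a3) simp
    then show ?thesis by (simp add: hj_def case_prod_unfold)
  qed
  have conv_c: "convex_on (input_fiber ?C x) (\<lambda>u. hc (x, u))" if "x \<in> ?Xc" for x
  proof (rule ereal_convex_on_imp_convex_on)
    show "ereal_convex_on (input_fiber ?C x) (\<lambda>u. Gamma_c A H V \<alpha>3 x u r)"
      using M2c \<open>r > 0\<close> that by (simp add: R_c_def)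
  qed (use that in \<open>auto simp: Gamma_c_def input_fiber_def hc_def a3_def\<close>)
  have conv_d: "convex_on (input_fiber ?D x) (\<lambda>u. hj (x, u))" if "x \<in> ?Xd" for x
  proof (rule ereal_convex_on_imp_convex_on)
    show "ereal_convex_on (input_fiber ?D x) (\<lambda>u. Gamma_d A H V \<alpha>3 x u r)"
      using M2d \<open>r > 0\<close> that by (simp add: R_d_def)
  qed (use that in \<open>auto simp: Gamma_d_def input_fiber_def hj_def a3_def\<close>)
  have Xc_empty: "?C \<noteq> {}" if "x \<in> ?Xc" for x
    using that by (auto simp: R_c_def state_proj_def)

  have regular: "(\<forall>x \<in> ?Xc. \<exists>!u. is_arg_min norm (\<lambda>u. u \<in> T_c A Uc H V \<alpha>3 x) u) \<and>
       (\<forall>x \<in> ?Xd. \<exists>!u. is_arg_min norm (\<lambda>u. u \<in> T_d A Ud H V \<alpha>3 x) u) \<and>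
       (\<forall>\<rho>c \<rho>d. min_norm_pair A Uc Ud H V \<alpha>3 r \<rho>c \<rho>d \<longrightarrow>
          continuous_on ?Xc \<rho>c \<and> continuous_on ?Xd \<rho>d)"
    if graph_c: "has_closed_graph (input_fiber ?C)" and graph_d: "has_closed_graph (input_fiber ?D)"
      and sf: "strictly_feasible A Uc Ud H V \<alpha>3 r"
  proof -
    have slater_c: "\<exists>u\<in>input_fiber ?C x. hc (x, u) < 0" if x: "x \<in> ?Xc" for x
    proof -
      obtain u where "u \<in> input_fiber ?C x" "Upsilon_c A H V \<alpha>3 x u < 0"
        using sf x unfolding strictly_feasible_def by blast
      then show ?thesis
        by (intro bexI[of _ u])
          (auto simp: Upsilon_c_def Gamma_c_def superlevel_def input_fiber_def hc_def a3_def)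
    qed
    have slater_d: "\<exists>u\<in>input_fiber ?D x. hj (x, u) < 0" if x: "x \<in> ?Xd" for x
    proof -
      obtain u where "u \<in> input_fiber ?D x" "Upsilon_d A H V \<alpha>3 x u < 0"
        using sf x unfolding strictly_feasible_def by blast
      then show ?thesis
        by (intro bexI[of _ u])
          (auto simp: Upsilon_d_def Gamma_d_def superlevel_def input_fiber_def hj_def a3_def)
    qed
    show ?thesis
    proof (intro conjI ballI allI impI)
      show "\<exists>!u. is_arg_min norm (\<lambda>u. u \<in> T_c A Uc H V \<alpha>3 x) u" if "x \<in> ?Xc" for x
        unfolding Tc
        by (rule min_norm_selection_exists_unique[OF graph_c cont_hc[OF Xc_empty[OF that]]
              conv_c[OF that] slater_c[OF that]])
      show "\<exists>!u. is_arg_min norm (\<lambda>u. u \<in> T_d A Ud H V \<alpha>3 x) u" if "x \<in> ?Xd" for x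
        unfolding Td
        by (rule min_norm_selection_exists_unique[OF graph_d cont_hd conv_d[OF that] slater_d[OF that]])
      fix \<rho>c \<rho>d assume pair: "min_norm_pair A Uc Ud H V \<alpha>3 r \<rho>c \<rho>d"
      have sel_c: "is_arg_min norm (\<lambda>u. u \<in> feasible_inputs (input_fiber ?C) hc x) (\<rho>c x)"
        if "x \<in> ?Xc" for x
        using pair that unfolding min_norm_pair_def Tc by blast
      have sel_d: "is_arg_min norm (\<lambda>u. u \<in> feasible_inputs (input_fiber ?D) hj x) (\<rho>d x)"
        if "x \<in> ?Xd" for x
        using pair that unfolding min_norm_pair_def Td by blast
      show "continuous_on ?Xc \<rho>c"
      proof (cases "?C = {}")
        case True
        then have "?Xc = {}" using Xc_empty by blast
        then show ?thesis by simp
      next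
        case False
        show ?thesis
          by (rule min_norm_selection_continuous[OF graph_c M1c(1) cont_hc[OF False]
                conv_c slater_c sel_c])
      qed
      show "continuous_on ?Xd \<rho>d"
        by (rule min_norm_selection_continuous[OF graph_d M1d(1) cont_hd conv_d slater_d sel_d])
    qed
  qed
  show "(?C \<noteq> {} \<or> ?D \<noteq> {} \<longrightarrow> compact {x. V x \<le> r}) \<and>
    (\<forall>\<rho>c \<rho>d. min_norm_pair A Uc Ud H V \<alpha>3 r \<rho>c \<rho>d \<longrightarrow>
       asymptotically_stable (closed_loop (restrict_system V r H) ?Xc \<rho>c ?Xd \<rho>d) {x. V x \<le> r}) \<and>
    (has_closed_graph (input_fiber ?C) \<and> has_closed_graph (input_fiber ?D) \<and>
     strictly_feasible A Uc Ud H V \<alpha>3 r \<longrightarrow>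
       (\<forall>x \<in> ?Xc. \<exists>!u. is_arg_min norm (\<lambda>u. u \<in> T_c A Uc H V \<alpha>3 x) u) \<and>
       (\<forall>x \<in> ?Xd. \<exists>!u. is_arg_min norm (\<lambda>u. u \<in> T_d A Ud H V \<alpha>3 x) u) \<and>
       (\<forall>\<rho>c \<rho>d. min_norm_pair A Uc Ud H V \<alpha>3 r \<rho>c \<rho>d \<longrightarrow>
          continuous_on ?Xc \<rho>c \<and> continuous_on ?Xd \<rho>d))"
    using compact stable regular by (intro conjI allI impI) simp_all
qed

end
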